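(* Let $G$ be a bipartite graph with sides $A$ and $B$, both infinite, such that $G$ is a dHp graph and every vertex of $A$ has finite degree in $G$. If only finitely many vertices of $B$ have finite degree in $G$, then there is a collection of pairwise vertex-disjoint 2-regular subgraphs of $G$ covering all the vertices of $A$.
   Context: For $X\subseteq V(G)$ with $|X|\ge 2$, $N^2(X)$ denotes the set of vertices of $G$ having at least two neighbours in $X$. A bipartite graph $G$ with sides $A$ and $B$ is a dHp graph if $|A|\ge 2$ and $|N^2(X)|\ge |X|$ for every $X\subseteq A$ with $|X|\ge 2$. A 2-regular subgraph is a subgraph in which every vertex has degree exactly $2$. A collection of subgraphs covers $A$ if every vertex of $A$ lies in one of them. *)

theory Defs
  imports "HOL-Library.Equipollence"
begin

text \<open>Simple undirected graphs, possibly infinite of any cardinality.\<close>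

record 'a ugraph =
  verts :: "'a set"
  edges :: "'a set set"

definition simple_graph :: "'a ugraph \<Rightarrow> bool" where
  "simple_graph G \<longleftrightarrow>
     (\<forall>e\<in>edges G. \<exists>u v. e = {u, v} \<and> u \<noteq> v \<and> u \<in> verts G \<and> v \<in> verts G)"

definition neighbours :: "'a ugraph \<Rightarrow> 'a \<Rightarrow> 'a set" where
  "neighbours G v = {u. {v, u} \<in> edges G}"

definition finite_degree :: "'a ugraph \<Rightarrow> 'a \<Rightarrow> bool" where
  "finite_degree G v \<longleftrightarrow> finite (neighbours G v)"

definition bipartite_graph :: "'a ugraph \<Rightarrow> 'a set \<Rightarrow> 'a set \<Rightarrow> bool" where
  "bipartite_graph G A B \<longleftrightarrow>
     simple_graph G \<and> verts G = A \<union> B \<and> A \<inter> B = {} \<and>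
     (\<forall>e\<in>edges G. \<exists>a\<in>A. \<exists>b\<in>B. e = {a, b})"

text \<open>Since \<open>card\<close> is 0 on infinite sets, these are included explicitly.\<close>

definition at_least_two :: "'a set \<Rightarrow> bool" where
  "at_least_two S \<longleftrightarrow> infinite S \<or> 2 \<le> card S"

definition N2 :: "'a ugraph \<Rightarrow> 'a set \<Rightarrow> 'a set" where
  "N2 G X = {v \<in> verts G. at_least_two (neighbours G v \<inter> X)}"

text \<open>\<open>X\<close> may be infinite, so \<open>\<lesssim>\<close> compares cardinals rather than values of \<open>card\<close>.\<close>

definition dHp_graph :: "'a ugraph \<Rightarrow> 'a set \<Rightarrow> 'a set \<Rightarrow> bool" where
  "dHp_graph G A B \<longleftrightarrow>
     bipartite_graph G A B \<and> at_least_two A \<and>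
     (\<forall>X. X \<subseteq> A \<and> at_least_two X \<longrightarrow> X \<lesssim> N2 G X)"

definition subgraph :: "'a ugraph \<Rightarrow> 'a ugraph \<Rightarrow> bool" where
  "subgraph H G \<longleftrightarrow> simple_graph H \<and> verts H \<subseteq> verts G \<and> edges H \<subseteq> edges G"

definition two_regular :: "'a ugraph \<Rightarrow> bool" where
  "two_regular H \<longleftrightarrow> (\<forall>v\<in>verts H. card (neighbours H v) = 2)"

end

theory Submission
  imports Defs "HOL-Library.Countable_Set"
begin

text \<open>
  A finite bipartite graph with the double Hall property has a 2-factor covering \<open>A\<close>: such a factor
  is a perfect matching of a gadget graph, and a minimal Tutte barrier of the gadget graph is
  impossible, because parity alone pays for the odd components once \<open>|N\<^sup>2(T)| \<ge> |T|\<close> is known for the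
  set \<open>T\<close> of those \<open>a\<close> whose dummy vertices lie in the barrier.

  In the infinite graph only finitely many vertices of \<open>A\<close> have degree at most \<open>d\<close>, since otherwise
  a sunflower of neighbourhoods violates the double Hall property; so \<open>A\<close> is countable. A limit of
  2-factors of finite parts gives every \<open>a\<close> exactly two edges and every \<open>b\<close> at most two, where a
  \<open>b\<close> with exactly one edge must have infinite degree. Such a \<open>b\<close> takes over a fresh neighbour \<open>a\<close>
  from some other \<open>b'\<close> of infinite degree, which may then be deficient itself; repeating this pushes
  all deficiencies to infinity.
\<close>

section \<open>Maximum matchings and Tutte barriers\<close>

text \<open>Tutte's condition is reached through the Tutte-Berge form because the induction deletes
  a vertex that every maximum matching covers, and a count of uncovered vertices survives the
  deletion. A barrier of least size is all-or-nothing: each of its vertices sees three components,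
  while gadget vertices with common neighbours would merge these, so the barrier is described by a
  few subsets of the two sides and can be counted. The double Hall property is silent about a single
  \<open>a\<close>; only there can the count fall short, by at most two, and a second vertex of
  \<open>A\<close> supplies the missing two. In the limit a \<open>b\<close> loses a partner when
  that partner runs off to infinity along the finite factors, which cannot happen when all
  neighbours of \<open>b\<close> lie in one finite part. The vertices \<open>b\<close> of finite
  degree, being finitely many, have only finitely many neighbours together, so a \<open>b\<close> of
  infinite degree always finds a neighbour either of whose current partners can afford to lose an
  edge.\<close>

definition matching_on :: "'v set \<Rightarrow> ('v \<Rightarrow> 'v \<Rightarrow> bool) \<Rightarrow> ('v \<Rightarrow> 'v) \<Rightarrow> bool" where
  "matching_on V adj m \<longleftrightarrow> (\<forall>x\<in>V. m x \<in> V \<and> m (m x) = x \<and> (m x \<noteq> x \<longrightarrow> adj x (m x)))"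

text \<open>Matchings are encoded as involutions so that uncovered vertices are fixed points,
  exchanging an edge is a function update, and parity statements are statements about
  involutions.\<close>

definition free_verts :: "'v set \<Rightarrow> ('v \<Rightarrow> 'v) \<Rightarrow> 'v set" where
  "free_verts V m = {x \<in> V. m x = x}"

definition max_matching :: "'v set \<Rightarrow> ('v \<Rightarrow> 'v \<Rightarrow> bool) \<Rightarrow> ('v \<Rightarrow> 'v) \<Rightarrow> bool" where
  "max_matching V adj m \<longleftrightarrow> matching_on V adj m \<and>
     (\<forall>n. matching_on V adj n \<longrightarrow> card (free_verts V m) \<le> card (free_verts V n))"

definition joined :: "('v \<Rightarrow> 'v \<Rightarrow> bool) \<Rightarrow> 'v set \<Rightarrow> 'v rel" where
  "joined adj W = {(x, y). x \<in> W \<and> y \<in> W \<and> adj x y}\<^sup>*"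

definition odd_comps :: "('v \<Rightarrow> 'v \<Rightarrow> bool) \<Rightarrow> 'v set \<Rightarrow> 'v set set" where
  "odd_comps adj W = {C. \<exists>x\<in>W. C = joined adj W `` {x} \<and> odd (card C)}"

lemma even_card_moved:
  assumes "finite V" "\<And>x. x \<in> V \<Longrightarrow> m x \<in> V \<and> m (m x) = x"
  shows "even (card {x \<in> V. m x \<noteq> x})"
  using assms
proof (induction "card V" arbitrary: V rule: less_induct)
  case less
  show ?case
  proof (cases "\<exists>x\<in>V. m x \<noteq> x")
    case False
    then have "{x \<in> V. m x \<noteq> x} = {}" by blast
    then show ?thesis by (simp only: card.empty even_zero)
  next
    case True
    then obtain x where x: "x \<in> V" "m x \<noteq> x" by blast
    let ?V = "V - {x, m x}"
    have "even (card {y \<in> ?V. m y \<noteq> y})"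
    proof (rule less.hyps)
      show "card ?V < card V"
        using x less.prems(1) by (intro psubset_card_mono) auto
      show "finite ?V" using less.prems(1) by simp
      show "m y \<in> ?V \<and> m (m y) = y" if "y \<in> ?V" for y
        using that less.prems(2)[of y] less.prems(2)[of x] x by auto
    qed
    moreover have "{y \<in> V. m y \<noteq> y} = insert x (insert (m x) {y \<in> ?V. m y \<noteq> y})"
      using x less.prems(2)[of x] by auto
    moreover have "finite {y \<in> ?V. m y \<noteq> y}" using less.prems(1) by simp
    ultimately show ?thesis using x by simp
  qed
qed

lemma card_free_moved:
  assumes "finite V"
  shows "card V = card (free_verts V m) + card {x \<in> V. m x \<noteq> x}"
proof -
  have "V = free_verts V m \<union> {x \<in> V. m x \<noteq> x}" by (auto simp: free_verts_def)
  then show ?thesis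
    using assms card_Un_disjoint[of "free_verts V m" "{x \<in> V. m x \<noteq> x}"]
    by (auto simp: free_verts_def)
qed

lemma even_card_free:
  assumes "finite V" "matching_on V adj m"
  shows "even (card (free_verts V m)) \<longleftrightarrow> even (card V)"
proof -
  have "even (card {x \<in> V. m x \<noteq> x})"
    using assms by (intro even_card_moved) (auto simp: matching_on_def)
  then show ?thesis using card_free_moved[OF assms(1), of m] by presburger
qed

lemma max_matching_exists: "\<exists>m. max_matching V adj m"
proof -
  have "matching_on V adj id" by (simp add: matching_on_def)
  then show ?thesis
    unfolding max_matching_def
    using ex_has_least_nat[of "matching_on V adj" id "\<lambda>m. card (free_verts V m)"] by blast
qed

section \<open>Components and maximum matchings of a symmetric irreflexive relation\<close>

locale simple_adj =
  fixes adj :: "'v \<Rightarrow> 'v \<Rightarrow> bool"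
  assumes adj_sym: "adj x y \<Longrightarrow> adj y x"
    and adj_irrefl: "\<not> adj x x"
begin

lemma joined_refl: "(x, x) \<in> joined adj W"
  by (simp add: joined_def)

lemma joined_trans: "(x, y) \<in> joined adj W \<Longrightarrow> (y, z) \<in> joined adj W \<Longrightarrow> (x, z) \<in> joined adj W"
  unfolding joined_def by (rule rtrancl_trans)

lemma joined_sym: "(x, y) \<in> joined adj W \<Longrightarrow> (y, x) \<in> joined adj W"
proof -
  have "sym {(x, y). x \<in> W \<and> y \<in> W \<and> adj x y}" by (auto simp: sym_def intro: adj_sym)
  then show "(x, y) \<in> joined adj W \<Longrightarrow> (y, x) \<in> joined adj W"
    unfolding joined_def by (meson sym_rtrancl symD)
qed

lemma joined_adj: "x \<in> W \<Longrightarrow> y \<in> W \<Longrightarrow> adj x y \<Longrightarrow> (x, y) \<in> joined adj W"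
  unfolding joined_def by auto

lemma joined_in: "(x, y) \<in> joined adj W \<Longrightarrow> x \<in> W \<Longrightarrow> y \<in> W"
  unfolding joined_def by (induction rule: rtrancl_induct) auto

lemma joined_mono: "W \<subseteq> W' \<Longrightarrow> joined adj W \<subseteq> joined adj W'"
  unfolding joined_def by (intro rtrancl_mono) auto

lemma joined_class_eq:
  "(x, y) \<in> joined adj W \<Longrightarrow> joined adj W `` {x} = joined adj W `` {y}"
  using joined_trans joined_sym by blast

lemma max_matching_no_free_edge:
  assumes "finite V" "max_matching V adj m" "x \<in> V" "y \<in> V" "m x = x" "m y = y"
  shows "\<not> adj x y"
proof
  assume a: "adj x y"
  then have ne: "x \<noteq> y" using adj_irrefl by blast
  let ?n = "m(x := y, y := x)"
  have m: "matching_on V adj m" using assms(2) by (simp add: max_matching_def)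
  have "matching_on V adj ?n"
    unfolding matching_on_def
  proof
    fix w assume w: "w \<in> V"
    have "m w \<in> V" "m (m w) = w" "m w \<noteq> w \<longrightarrow> adj w (m w)"
      using m w by (auto simp: matching_on_def)
    moreover have "m w \<noteq> x" if "w \<noteq> x" using calculation(2) assms(5) that by metis
    moreover have "m w \<noteq> y" if "w \<noteq> y" using calculation(2) assms(6) that by metis
    ultimately show "?n w \<in> V \<and> ?n (?n w) = w \<and> (?n w \<noteq> w \<longrightarrow> adj w (?n w))"
      using assms(3,4) a adj_sym ne by auto
  qed
  then have "card (free_verts V m) \<le> card (free_verts V ?n)"
    using assms(2) by (simp add: max_matching_def)
  moreover have "free_verts V ?n \<subset> free_verts V m"
    using assms ne by (auto simp: free_verts_def split: if_splits)
  moreover have "finite (free_verts V m)" using assms(1) by (simp add: free_verts_def)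
  ultimately show False using psubset_card_mono by (metis not_less)
qed

text \<open>The new edge covers \<open>x\<close> and releases only the old partner
  \<open>n y\<close>, so the number of uncovered vertices is unchanged.\<close>

lemma max_matching_swap:
  assumes fin: "finite V" and n: "max_matching V adj n"
    and x: "x \<in> V" "n x = x" and y: "y \<in> V" "n y \<noteq> y" and a: "adj x y"
  shows "max_matching V adj (n(x := y, y := x, n y := n y))"
proof -
  let ?n = "n(x := y, y := x, n y := n y)"
  have mn: "matching_on V adj n" using n by (simp add: max_matching_def)
  have z: "n y \<in> V" "n (n y) = y" using mn y by (auto simp: matching_on_def)
  have ne: "x \<noteq> y" "n y \<noteq> x" using x y z by auto
  have mm: "matching_on V adj ?n"
    unfolding matching_on_def
  proof
    fix w assume w: "w \<in> V"
    have "n w \<in> V" "n (n w) = w" "n w \<noteq> w \<longrightarrow> adj w (n w)"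
      using mn w by (auto simp: matching_on_def)
    moreover have "n w \<noteq> x" if "w \<noteq> x" using calculation(2) x that by metis
    moreover have "n w \<noteq> y" if "w \<noteq> n y" using calculation(2) that by metis
    moreover have "n w \<noteq> n y" if "w \<noteq> y" using calculation(2) z that by metis
    ultimately show "?n w \<in> V \<and> ?n (?n w) = w \<and> (?n w \<noteq> w \<longrightarrow> adj w (?n w))"
      using x y z a adj_sym ne by auto
  qed
  have fv: "free_verts V ?n = insert (n y) (free_verts V n - {x})"
    using x y z ne by (auto simp: free_verts_def)
  have f: "finite (free_verts V n)" using fin by (simp add: free_verts_def)
  have "x \<in> free_verts V n" "n y \<notin> free_verts V n"
    using x y z by (auto simp: free_verts_def)
  then have "card (free_verts V ?n) = card (free_verts V n)"
    unfolding fv using f by (simp add: card_Suc_Diff1 del: card_Diff_insert)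
  then show ?thesis using mm n by (simp add: max_matching_def)
qed

text \<open>Gallai's lemma. Among the maximum matchings missing a vertex \<open>t\<close> strictly between \<open>u\<close> and
  \<open>v\<close>, take one sharing as much as possible with a maximum matching missing \<open>u\<close> and \<open>v\<close>; an edge
  swap increases the common part.\<close>

lemma gallai:
  assumes fin: "finite V"
    and all_missed: "\<And>v. v \<in> V \<Longrightarrow> \<exists>m. max_matching V adj m \<and> m v = v"
    and M: "max_matching V adj M"
    and "(u, v) \<in> {(x, y). x \<in> V \<and> y \<in> V \<and> adj x y} ^^ k"
    and "u \<in> V" "u \<noteq> v" "M u = u"
  shows "M v \<noteq> v"
  using M assms(4-7)
proof (induction k arbitrary: u v M rule: less_induct)
  case (less k)
  let ?R = "{(x, y). x \<in> V \<and> y \<in> V \<and> adj x y}"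
  show ?case
  proof
    assume Mv: "M v = v"
    obtain j where k: "k = Suc j"
      using less.prems(2,4) by (cases k) auto
    obtain t where t: "(u, t) \<in> ?R ^^ j" "(t, v) \<in> ?R"
      using less.prems(2) k by auto
    have tv: "t \<in> V" "v \<in> V" "t \<noteq> v" "adj t v" using t(2) adj_irrefl by auto
    have "t \<noteq> u"
      using max_matching_no_free_edge[OF fin less.prems(1)] less.prems(3,5) tv Mv by auto
    \<comment> \<open>The walk from \<open>u\<close> to \<open>t\<close> has length
      \<open>j < k\<close>, so the induction hypothesis applies to every maximum matching that
      misses \<open>u\<close>.\<close>
    have ut: "m t \<noteq> t" if "max_matching V adj m" "m u = u" for m
      using less.IH[of j m u t] that k t(1) less.prems(3) \<open>t \<noteq> u\<close> by auto
    have tv': "m v \<noteq> v" if "max_matching V adj m" "m t = t" for m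
      using max_matching_no_free_edge[OF fin that(1), of t v] that(2) tv by auto
    let ?P = "\<lambda>n. max_matching V adj n \<and> n t = t"
    let ?c = "\<lambda>n. card {x \<in> V. M x = n x \<and> M x \<noteq> x}"
    obtain n0 where n0: "?P n0" using all_missed tv by blast
    have "\<exists>n. ?P n \<and> (\<forall>n'. ?P n' \<longrightarrow> ?c n' \<le> ?c n)"
    proof (rule ex_has_greatest_nat[of ?P n0 ?c "Suc (card V)"])
      show "?P n0" by (rule n0)
      show "\<forall>y. ?P y \<longrightarrow> ?c y < Suc (card V)"
        using fin by (auto intro!: le_imp_less_Suc card_mono)
    qed
    then obtain n where n: "max_matching V adj n" "n t = t"
      and best: "\<And>n'. ?P n' \<Longrightarrow> ?c n' \<le> ?c n" by blast
    have Mt: "M t \<noteq> t" using ut less.prems(1,5) by blast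
    have nu: "n u \<noteq> u" using ut n by blast
    have nv: "n v \<noteq> v" using tv' n by blast
    have fM: "finite (free_verts V M)" and fn: "finite (free_verts V n)"
      using fin by (auto simp: free_verts_def)
    have "card (free_verts V M) = card (free_verts V n)"
      using less.prems(1) n(1) by (meson max_matching_def le_antisym)
    then have "card (free_verts V n - free_verts V M) = card (free_verts V M - free_verts V n)"
      using fM fn by (metis card_Diff_subset_Int finite_Int inf_commute)
    moreover have "card {u, v} \<le> card (free_verts V M - free_verts V n)"
      using fM less.prems nu nv Mv tv by (intro card_mono) (auto simp: free_verts_def)
    \<comment> \<open>\<open>n\<close> covers \<open>u\<close> and \<open>v\<close>, which
      \<open>M\<close> misses, and both miss equally many vertices. Hence \<open>n\<close> misses
      two vertices covered by \<open>M\<close>; at most one of them is \<open>t\<close>, the other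
      becomes \<open>x\<close>.\<close>
    ultimately have two: "2 \<le> card (free_verts V n - free_verts V M)"
      using less.prems(4) by simp
    have "\<not> free_verts V n - free_verts V M \<subseteq> {t}"
    proof
      assume "free_verts V n - free_verts V M \<subseteq> {t}"
      then have "card (free_verts V n - free_verts V M) \<le> card {t}" by (intro card_mono) auto
      then show False using two by simp
    qed
    then obtain x where x: "x \<in> V" "n x = x" "M x \<noteq> x" "x \<noteq> t"
      by (auto simp: free_verts_def)
    define y where "y = M x"
    have y: "y \<in> V" "M y = x" "adj x y" "y \<noteq> x"
      using less.prems(1) x unfolding max_matching_def matching_on_def y_def by auto
    have ny: "n y \<noteq> y"
      using max_matching_no_free_edge[OF fin n(1), of x y] x y by blast
    have z: "n y \<in> V" "n (n y) = y"
      using n(1) y(1) by (auto simp: max_matching_def matching_on_def)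
    let ?n = "n(x := y, y := x, n y := n y)"
    have "max_matching V adj ?n"
      using max_matching_swap[OF fin n(1) x(1,2) y(1) ny y(3)] .
    moreover have "t \<noteq> y" using ny n(2) by auto
    ultimately have "?c ?n \<le> ?c n" using best[of ?n] x n(2) by auto
    moreover have "{w \<in> V. M w = n w \<and> M w \<noteq> w} \<subset> {w \<in> V. M w = ?n w \<and> M w \<noteq> w}"
    proof
      \<comment> \<open>The only pair given up by the swap is \<open>y\<close> with
        \<open>n y\<close>, and this was no pair of \<open>M\<close> because
        \<open>M y = x\<close>.\<close>
      have "M (n y) \<noteq> n (n y)"
      proof
        assume "M (n y) = n (n y)"
        then have "M y = n y"
          using z less.prems(1) unfolding max_matching_def matching_on_def by metis
        then have "n y = x" using y by simp
        then show False using z x y by auto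
      qed
      then show "{w \<in> V. M w = n w \<and> M w \<noteq> w} \<subseteq> {w \<in> V. M w = ?n w \<and> M w \<noteq> w}"
        using x y z by auto
      have "x \<in> {w \<in> V. M w = ?n w \<and> M w \<noteq> w}" "x \<notin> {w \<in> V. M w = n w \<and> M w \<noteq> w}"
        using x y z y_def by auto
      then show "{w \<in> V. M w = n w \<and> M w \<noteq> w} \<noteq> {w \<in> V. M w = ?n w \<and> M w \<noteq> w}" by blast
    qed
    moreover have "finite {w \<in> V. M w = ?n w \<and> M w \<noteq> w}" using fin by simp
    ultimately show False using psubset_card_mono by (metis (lifting) not_less)
  qed
qed

text \<open>A vertex covered by every maximum matching goes into \<open>U\<close>, and induction
  handles the rest. If there is no such vertex, Gallai's lemma allows at most one uncovered vertex
  per component; the matching pairs up the remainder, so each uncovered vertex has an odd component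
  of its own and \<open>U = {}\<close> works.\<close>

lemma tutte_berge:
  assumes "finite V"
  shows "\<exists>m U. matching_on V adj m \<and> U \<subseteq> V \<and>
           card (free_verts V m) + card U \<le> card (odd_comps adj (V - U))"
  using assms
proof (induction "card V" arbitrary: V rule: less_induct)
  case less
  note fin = less.prems
  show ?case
  proof (cases "\<forall>v\<in>V. \<exists>m. max_matching V adj m \<and> m v = v")
    case False
    then obtain v where v: "v \<in> V" "\<And>m. max_matching V adj m \<Longrightarrow> m v \<noteq> v" by blast
    have "card (V - {v}) < card V" using v fin by (intro psubset_card_mono) auto
    then obtain m' U where m': "matching_on (V - {v}) adj m'" and U: "U \<subseteq> V - {v}"
      and le: "card (free_verts (V - {v}) m') + card U \<le> card (odd_comps adj (V - {v} - U))"
      using less.hyps[of "V - {v}"] fin by auto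
    obtain m where m: "max_matching V adj m" using max_matching_exists by blast
    let ?m = "m'(v := v)"
    have mm: "matching_on V adj ?m"
      using m' v(1) unfolding matching_on_def by (auto split: if_splits)
    then have "\<not> max_matching V adj ?m" using v(2)[of ?m] by auto
    then have "card (free_verts V m) < card (free_verts V ?m)"
      using m mm unfolding max_matching_def by (meson le_less_trans not_le)
    moreover have "free_verts V ?m = insert v (free_verts (V - {v}) m')"
      using v(1) by (auto simp: free_verts_def)
    then have "card (free_verts V ?m) = Suc (card (free_verts (V - {v}) m'))"
      using fin by (simp add: free_verts_def)
    \<comment> \<open>Equal parity turns the strict inequality into a gap of two. One of the two is
      \<open>v\<close> itself, uncovered by \<open>?m\<close>; the other pays for putting
      \<open>v\<close> into \<open>U\<close>.\<close>
    moreover have "even (card (free_verts V m)) = even (card (free_verts V ?m))"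
      using even_card_free[OF fin mm] even_card_free[OF fin, of adj m] m
      by (simp add: max_matching_def)
    ultimately have "card (free_verts V m) + 1 \<le> card (free_verts (V - {v}) m')"
      by (metis Suc_eq_plus1 Suc_leI even_Suc less_Suc_eq_le nat_less_le)
    moreover have "card (insert v U) = Suc (card U)"
      using U fin by (subst card_insert_disjoint) (auto intro: finite_subset)
    moreover have "V - insert v U = V - {v} - U" by auto
    ultimately have "card (free_verts V m) + card (insert v U)
        \<le> card (odd_comps adj (V - insert v U))"
      using le by simp
    moreover have "insert v U \<subseteq> V" using U v by auto
    ultimately show ?thesis using m unfolding max_matching_def by blast
  next
    case True
    obtain m where m: "max_matching V adj m" using max_matching_exists by blast
    then have mm: "matching_on V adj m" by (simp add: max_matching_def)
    let ?K = "\<lambda>x. joined adj V `` {x}"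
    have apart: "m y \<noteq> y" if "x \<in> V" "m x = x" "(x, y) \<in> joined adj V" "x \<noteq> y" for x y
    proof -
      obtain k where "(x, y) \<in> {(x, y). x \<in> V \<and> y \<in> V \<and> adj x y} ^^ k"
        using \<open>(x, y) \<in> joined adj V\<close> unfolding joined_def by (auto dest: rtrancl_imp_relpow)
      then show ?thesis
        using gallai[OF fin _ m, of x y k] True that by blast
    qed
    have "inj_on ?K (free_verts V m)"
    proof (rule inj_onI)
      fix x y assume "x \<in> free_verts V m" "y \<in> free_verts V m" "?K x = ?K y"
      then show "x = y"
        using apart[of x y] joined_refl by (fastforce simp: free_verts_def)
    qed
    moreover have "?K ` free_verts V m \<subseteq> odd_comps adj V"
    proof
      fix C assume "C \<in> ?K ` free_verts V m"
      then obtain x where x: "x \<in> V" "m x = x" "C = ?K x" by (auto simp: free_verts_def)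
      have CV: "C \<subseteq> V" using x joined_in by auto
      then have fC: "finite C" using fin finite_subset by blast
      have "matching_on C adj m"
        unfolding matching_on_def
      proof
        fix w assume w: "w \<in> C"
        then have w': "m w \<in> V \<and> m (m w) = w \<and> (m w \<noteq> w \<longrightarrow> adj w (m w))"
          using mm CV unfolding matching_on_def by blast
        then have "(w, m w) \<in> joined adj V"
          using joined_adj[of w V "m w"] joined_refl w CV by (cases "m w = w") auto
        then have "m w \<in> C" using w x(3) joined_trans by blast
        then show "m w \<in> C \<and> m (m w) = w \<and> (m w \<noteq> w \<longrightarrow> adj w (m w))" using w' by simp
      qed
      then have "even (card (free_verts C m)) = even (card C)"
        using even_card_free fC by blast
      moreover have "free_verts C m = {x}"
        using x apart joined_refl by (auto simp: free_verts_def)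
      ultimately have "odd (card C)" by simp
      then show "C \<in> odd_comps adj V" using x by (auto simp: odd_comps_def)
    qed
    moreover have "finite (odd_comps adj V)"
    proof (rule finite_subset)
      show "odd_comps adj V \<subseteq> ?K ` V" by (auto simp: odd_comps_def)
    qed (use fin in simp)
    ultimately have "card (free_verts V m) \<le> card (odd_comps adj V)"
      by (metis card_image card_mono)
    then show ?thesis using mm by (intro exI[of _ m] exI[of _ "{}"]) auto
  qed
qed

section \<open>Minimal barriers\<close>

lemma odd_comps_finite: "finite W \<Longrightarrow> finite (odd_comps adj W)"
  by (rule finite_subset[of _ "(\<lambda>x. joined adj W `` {x}) ` W"]) (auto simp: odd_comps_def)

text \<open>Odd components not adjacent to \<open>u\<close> survive, and at most two are swallowed
  by the component of \<open>u\<close>. If exactly two are swallowed, the component of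
  \<open>u\<close> is itself odd, so the net loss is at most one.\<close>

lemma card_odd_comps_insert:
  assumes fin: "finite W" and u: "u \<notin> W"
    and no3: "\<And>x y z. x \<in> W \<Longrightarrow> y \<in> W \<Longrightarrow> z \<in> W \<Longrightarrow> adj u x \<Longrightarrow> adj u y \<Longrightarrow> adj u z \<Longrightarrow>
      (x, y) \<in> joined adj W \<or> (x, z) \<in> joined adj W \<or> (y, z) \<in> joined adj W"
  shows "card (odd_comps adj W) \<le> Suc (card (odd_comps adj (insert u W)))"
proof -
  let ?K = "\<lambda>x. joined adj W `` {x}"
  let ?K' = "\<lambda>x. joined adj (insert u W) `` {x}"
  define P where "P = {C \<in> odd_comps adj W. \<exists>x\<in>C. adj u x}"
  define R where "R = odd_comps adj W - P"
  have finO: "finite (odd_comps adj W)" "finite (odd_comps adj (insert u W))"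
    using odd_comps_finite fin by auto
  then have finP: "finite P" "finite R" by (auto simp: P_def R_def)
  have sum: "card (odd_comps adj W) = card R + card P"
    using finO(1) unfolding R_def P_def
    by (metis (no_types, lifting) card_Diff_subset card_mono finP(1) P_def le_add_diff_inverse2 mem_Collect_eq subsetI)
  have KW: "?K x \<subseteq> W" if "x \<in> W" for x using that joined_in by auto
  have P2: "card P \<le> 2"
  proof (rule ccontr)
    assume "\<not> card P \<le> 2"
    then obtain Q where Q: "Q \<subseteq> P" "card Q = 3"
      by (metis Suc_leI not_le numeral_2_eq_2 numeral_3_eq_3 obtain_subset_with_card_n)
    then obtain C D E where CDE: "Q = {C, D, E}" "C \<noteq> D" "D \<noteq> E" "C \<noteq> E"
      by (auto simp: card_3_iff)
    have rep: "\<exists>x\<in>W. adj u x \<and> Z = ?K x" if "Z \<in> Q" for Z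
    proof -
      have "Z \<in> P" using that Q(1) by blast
      then obtain w x where "w \<in> W" "Z = ?K w" "x \<in> Z" "adj u x"
        unfolding P_def odd_comps_def by blast
      then show ?thesis using joined_class_eq[of w x W] KW[of w] by (intro bexI[of _ x]) auto
    qed
    obtain x where x: "x \<in> W" "adj u x" "C = ?K x" using rep[of C] CDE(1) by auto
    obtain y where y: "y \<in> W" "adj u y" "D = ?K y" using rep[of D] CDE(1) by auto
    obtain z where z: "z \<in> W" "adj u z" "E = ?K z" using rep[of E] CDE(1) by auto
    have "(x, y) \<notin> joined adj W" "(x, z) \<notin> joined adj W" "(y, z) \<notin> joined adj W"
      using CDE x(3) y(3) z(3) joined_class_eq by metis+
    then show False using no3[of x y z] x y z by simp
  qed
  have RO: "R \<subseteq> odd_comps adj (insert u W) - {?K' u}"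
  proof
    fix C assume "C \<in> R"
    then obtain x where x: "x \<in> W" "C = ?K x" "odd (card C)" and nadj: "\<And>y. y \<in> C \<Longrightarrow> \<not> adj u y"
      unfolding R_def P_def odd_comps_def by blast
    have "y \<in> C" if "(x, y) \<in> joined adj (insert u W)" for y
      using that unfolding joined_def
    proof (induction rule: rtrancl_induct)
      case base then show ?case using x joined_refl by auto
    next
      case (step y z)
      then have "y \<in> W" using KW x by blast
      then have "y \<noteq> u" using u by blast
      have "z \<noteq> u" using step nadj adj_sym by blast
      then have "(y, z) \<in> joined adj W"
        using step \<open>y \<noteq> u\<close> by (intro joined_adj) auto
      then show ?case using step.IH x joined_trans by blast
    qed
    then have "C = ?K' x" using x joined_mono[of W "insert u W"] by blast
    moreover have "C \<noteq> ?K' u" using KW x u joined_refl by blast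
    ultimately show "C \<in> odd_comps adj (insert u W) - {?K' u}"
      using x by (auto simp: odd_comps_def)
  qed
  show ?thesis
  proof (cases "card P = 2")
    case False
    then have "card P \<le> 1" using P2 by linarith
    moreover have "card R \<le> card (odd_comps adj (insert u W))"
      using RO finO by (intro card_mono) auto
    ultimately show ?thesis using sum by simp
  next
    case True
    \<comment> \<open>All components touching \<open>u\<close>, whether odd or even. Exactly two of
      them are odd, so their union is even and adding \<open>u\<close> makes it odd.\<close>
    define Q where "Q = {C. \<exists>x\<in>W. C = ?K x \<and> adj u x}"
    have QW: "\<Union>Q \<subseteq> W" using KW by (auto simp: Q_def)
    have finQ: "finite Q" unfolding Q_def using fin by simp
    have "card (\<Union>Q) = sum card Q"
    proof (rule card_Union_disjoint)
      show "pairwise disjnt Q"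
      proof (rule pairwiseI)
        fix C D assume "C \<in> Q" "D \<in> Q" "C \<noteq> D"
        then obtain x y where xy: "C = ?K x" "D = ?K y" by (auto simp: Q_def)
        have "C = D" if "w \<in> C" "w \<in> D" for w
          using that joined_class_eq[of x w W] joined_class_eq[of y w W] xy by simp
        then show "disjnt C D" using \<open>C \<noteq> D\<close> by (auto simp: disjnt_def)
      qed
      show "finite C" if "C \<in> Q" for C
      proof (rule finite_subset[OF _ fin])
        show "C \<subseteq> W" using that QW by blast
      qed
    qed
    moreover have "even (sum card Q) \<longleftrightarrow> even (card {C \<in> Q. odd (card C)})"
      by (rule even_sum_iff[OF finQ])
    moreover have "{C \<in> Q. odd (card C)} = P"
    proof
      show "{C \<in> Q. odd (card C)} \<subseteq> P"
        using joined_refl by (auto simp: Q_def P_def odd_comps_def)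
      show "P \<subseteq> {C \<in> Q. odd (card C)}"
      proof
        fix C assume "C \<in> P"
        then obtain x y where xy: "x \<in> W" "C = ?K x" "odd (card C)" "y \<in> C" "adj u y"
          by (auto simp: P_def odd_comps_def)
        then have "C = ?K y" "y \<in> W" using joined_class_eq[of x y W] KW by auto
        then show "C \<in> {C \<in> Q. odd (card C)}" using xy by (auto simp: Q_def)
      qed
    qed
    ultimately have "even (card (\<Union>Q))" using True by simp
    moreover have "?K' u = insert u (\<Union>Q)"
    proof
      show "insert u (\<Union>Q) \<subseteq> ?K' u"
      proof
        fix y assume "y \<in> insert u (\<Union>Q)"
        then consider "y = u" | x where "x \<in> W" "adj u x" "(x, y) \<in> joined adj W"
          by (auto simp: Q_def)
        then show "y \<in> ?K' u"
        proof cases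
          case 1 then show ?thesis using joined_refl by simp
        next
          case 2
          then have "(u, x) \<in> joined adj (insert u W)" by (intro joined_adj) auto
          moreover have "(x, y) \<in> joined adj (insert u W)"
            using 2 joined_mono[of W "insert u W"] by blast
          ultimately show ?thesis using joined_trans by blast
        qed
      qed
      show "?K' u \<subseteq> insert u (\<Union>Q)"
      proof
        fix y assume "y \<in> ?K' u"
        then have "(u, y) \<in> joined adj (insert u W)" by simp
        then show "y \<in> insert u (\<Union>Q)"
          unfolding joined_def
        proof (induction rule: rtrancl_induct)
          case base then show ?case by simp
        next
          case (step y z)
          show ?case
          proof (cases "z = u")
            case False
            then have z: "z \<in> W" "adj y z" using step.hyps by auto
            show ?thesis
            proof (cases "y = u")
              case True
              then have "?K z \<in> Q" using z by (auto simp: Q_def)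
              then show ?thesis using joined_refl by blast
            next
              case False
              then obtain x where x: "?K x \<in> Q" "(x, y) \<in> joined adj W"
                using step.IH by (auto simp: Q_def)
              have "y \<in> W" using step.hyps False by auto
              then have "(x, z) \<in> joined adj W"
                using x z joined_adj joined_trans by blast
              then show ?thesis using x by blast
            qed
          qed simp
        qed
      qed
    qed
    moreover have "u \<notin> \<Union>Q" "finite (\<Union>Q)" using QW u fin finite_subset by auto
    ultimately have "odd (card (?K' u))" by simp
    then have "?K' u \<in> odd_comps adj (insert u W)" by (auto simp: odd_comps_def)
    then have "insert (?K' u) R \<subseteq> odd_comps adj (insert u W)" "?K' u \<notin> R" using RO by auto
    then have "Suc (card R) \<le> card (odd_comps adj (insert u W))"
      using finO finP by (metis card_insert_disjoint card_mono)
    then show ?thesis using sum True by simp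
  qed
qed

text \<open>Take a barrier of least size. If \<open>u\<close> did not see three different
  components, moving \<open>u\<close> out would cost at most one odd component while
  \<open>card U\<close> drops by one, leaving a smaller barrier.\<close>

lemma perfect_matching_or_barrier:
  assumes fin: "finite V"
  obtains (perfect) m where "matching_on V adj m" "\<And>x. x \<in> V \<Longrightarrow> m x \<noteq> x"
  | (barrier) U where "U \<subseteq> V" "card U < card (odd_comps adj (V - U))"
      "\<And>u. u \<in> U \<Longrightarrow> \<exists>x\<in>V - U. \<exists>y\<in>V - U. \<exists>z\<in>V - U. adj u x \<and> adj u y \<and> adj u z \<and>
        (x, y) \<notin> joined adj (V - U) \<and> (x, z) \<notin> joined adj (V - U) \<and> (y, z) \<notin> joined adj (V - U)"
proof (cases "\<exists>U\<subseteq>V. card U < card (odd_comps adj (V - U))")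
  case False
  obtain m U where m: "matching_on V adj m" "U \<subseteq> V"
      "card (free_verts V m) + card U \<le> card (odd_comps adj (V - U))"
    using tutte_berge[OF fin] by blast
  have "\<not> card U < card (odd_comps adj (V - U))" using False m(2) by blast
  then have "card (free_verts V m) = 0" using m(3) by linarith
  then have "free_verts V m = {}" using fin by (simp add: free_verts_def)
  then show ?thesis using perfect m(1) by (auto simp: free_verts_def)
next
  case True
  let ?P = "\<lambda>U. U \<subseteq> V \<and> card U < card (odd_comps adj (V - U))"
  obtain U0 where "?P U0" using True by blast
  then have "\<exists>U. ?P U \<and> (\<forall>U'. ?P U' \<longrightarrow> card U \<le> card U')"
    by (rule ex_has_least_nat)
  then obtain U where U: "?P U" and least: "\<And>U'. ?P U' \<Longrightarrow> card U \<le> card U'"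
    by (elim exE conjE) simp
  show ?thesis
  proof (rule barrier[of U])
    fix u assume u: "u \<in> U"
    let ?W = "V - U"
    show "\<exists>x\<in>?W. \<exists>y\<in>?W. \<exists>z\<in>?W. adj u x \<and> adj u y \<and> adj u z \<and>
        (x, y) \<notin> joined adj ?W \<and> (x, z) \<notin> joined adj ?W \<and> (y, z) \<notin> joined adj ?W"
    proof (rule ccontr)
      assume "\<not> ?thesis"
      then have "card (odd_comps adj ?W) \<le> Suc (card (odd_comps adj (insert u ?W)))"
        using u fin by (intro card_odd_comps_insert) blast+
      moreover have "insert u ?W = V - (U - {u})" using u U by auto
      moreover have "card U = Suc (card (U - {u}))"
        using u U fin by (metis card_Suc_Diff1 finite_subset)
      ultimately have "?P (U - {u})" using U by auto
      then show False using least[of "U - {u}"] \<open>card U = Suc (card (U - {u}))\<close> by simp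
    qed
  qed (use U in auto)
qed

end

section \<open>Two-factors of finite double Hall graphs\<close>

text \<open>This is \<open>N\<^sup>2\<close> of \<open>T\<close>, phrased through the neighbourhood
  map of one side. It depends only on the values of \<open>N\<close> on \<open>T\<close>, so
  restricting to a finite part containing \<open>T\<close> does not change it.\<close>

definition linked :: "('a \<Rightarrow> 'b set) \<Rightarrow> 'a set \<Rightarrow> 'b set" where
  "linked N T = {b. \<exists>a\<in>T. \<exists>a'\<in>T. a \<noteq> a' \<and> b \<in> N a \<and> b \<in> N a'}"

text \<open>A perfect matching encodes a 2-factor: an edge vertex matched to a port is in the factor. The
  \<open>card (N a) - 2\<close> dummies of \<open>a\<close> absorb all but two of its edges, and the two ports of \<open>b\<close> are
  either both used or matched to each other.\<close>

datatype ('a, 'b) gadget = Edge 'a 'b | Dummy 'a nat | Port 'b bool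

fun gadj :: "('a, 'b) gadget \<Rightarrow> ('a, 'b) gadget \<Rightarrow> bool" where
  "gadj (Edge a b) (Dummy a' i) = (a = a')"
| "gadj (Dummy a' i) (Edge a b) = (a = a')"
| "gadj (Edge a b) (Port b' i) = (b = b')"
| "gadj (Port b' i) (Edge a b) = (b = b')"
| "gadj (Port b i) (Port b' j) = (b = b' \<and> i \<noteq> j)"
| "gadj _ _ = False"

interpretation gadget: simple_adj gadj
proof
  fix x y :: "('a, 'b) gadget"
  show "gadj x y \<Longrightarrow> gadj y x" by (cases x; cases y) auto
  show "\<not> gadj x x" by (cases x) auto
qed

section \<open>The gadget graph and its perfect matchings\<close>

locale finite_double_hall =
  fixes X :: "'a set" and N :: "'a \<Rightarrow> 'b set"
  assumes fin: "finite X"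
    and finN: "a \<in> X \<Longrightarrow> finite (N a)"
    and two: "2 \<le> card X"
    and double_hall: "T \<subseteq> X \<Longrightarrow> 2 \<le> card T \<Longrightarrow> card T \<le> card (linked N T)"
begin

definition V :: "('a, 'b) gadget set" where
  "V = {Edge a b | a b. a \<in> X \<and> b \<in> N a} \<union> {Dummy a i | a i. a \<in> X \<and> i + 2 < card (N a)}
     \<union> {Port b i | b i. b \<in> (\<Union>a\<in>X. N a)}"

lemma V_simps [simp]:
  "Edge a b \<in> V \<longleftrightarrow> a \<in> X \<and> b \<in> N a"
  "Dummy a i \<in> V \<longleftrightarrow> a \<in> X \<and> i + 2 < card (N a)"
  "Port b j \<in> V \<longleftrightarrow> (\<exists>a\<in>X. b \<in> N a)"
  by (auto simp: V_def)

lemma finite_V: "finite V"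
proof -
  have "V \<subseteq> (\<Union>a\<in>X. Edge a ` N a) \<union> (\<Union>a\<in>X. Dummy a ` {..<card (N a)})
      \<union> (\<Union>a\<in>X. (\<lambda>(b, i). Port b i) ` (N a \<times> UNIV))"
    by (fastforce simp: V_def)
  then show ?thesis by (rule finite_subset) (auto simp: fin finN)
qed

lemma common_neighbours:
  assumes "a \<in> X" "a' \<in> X" "a \<noteq> a'"
  shows "2 \<le> card (N a \<inter> N a')"
proof -
  have "2 \<le> card (linked N {a, a'})" using double_hall[of "{a, a'}"] assms by simp
  moreover have "linked N {a, a'} = N a \<inter> N a'" using assms by (auto simp: linked_def)
  ultimately show ?thesis by simp
qed

lemma degree_ge_2: "a \<in> X \<Longrightarrow> 2 \<le> card (N a)"
proof -
  assume a: "a \<in> X"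
  have "X \<noteq> {a}" using two by auto
  then obtain a' where "a' \<in> X" "a \<noteq> a'" using a by blast
  then have "2 \<le> card (N a \<inter> N a')" using common_neighbours a by blast
  also have "\<dots> \<le> card (N a)" using finN[OF a] by (intro card_mono) auto
  finally show ?thesis .
qed

lemma two_factor_of_perfect_matching:
  assumes m: "matching_on V gadj m" and perfect: "\<And>x. x \<in> V \<Longrightarrow> m x \<noteq> x"
  shows "\<exists>c. (\<forall>a\<in>X. c a \<subseteq> N a \<and> card (c a) = 2) \<and> (\<forall>b. card {a \<in> X. b \<in> c a} \<in> {0, 2})"
proof -
  have m1: "m x \<in> V" "m (m x) = x" "gadj x (m x)" if "x \<in> V" for x
    using m perfect that by (auto simp: matching_on_def)
  define c where "c a = {b \<in> N a. \<exists>i. m (Edge a b) = Port b i}" for a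
  have "card (c a) = 2" if a: "a \<in> X" for a
  proof -
    let ?D = "{b \<in> N a. \<exists>i. m (Edge a b) = Dummy a i}"
    let ?I = "{i. i + 2 < card (N a)}"
    \<comment> \<open>Dummies of \<open>a\<close> are adjacent only to edge vertices at
      \<open>a\<close>, so the matching itself is a bijection between them and the rejected edges
      \<open>?D\<close>, leaving two edges.\<close>
    have "bij_betw (\<lambda>i. THE b. m (Dummy a i) = Edge a b) ?I ?D"
    proof (rule bij_betw_byWitness[where f' = "\<lambda>b. THE i. m (Edge a b) = Dummy a i"])
      have I: "\<exists>b\<in>N a. m (Dummy a i) = Edge a b \<and> m (Edge a b) = Dummy a i" if "i \<in> ?I" for i
      proof -
        have "Dummy a i \<in> V" using a that by simp
        then show ?thesis using m1[of "Dummy a i"] by (cases "m (Dummy a i)") auto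
      qed
      have D: "\<exists>i\<in>?I. m (Dummy a i) = Edge a b \<and> m (Edge a b) = Dummy a i" if b: "b \<in> ?D" for b
      proof -
        obtain i where i: "m (Edge a b) = Dummy a i" using b by blast
        have "Edge a b \<in> V" using a b by simp
        then show ?thesis using m1[of "Edge a b"] i by auto
      qed
      show "\<forall>i\<in>?I. (THE j. m (Edge a (THE b. m (Dummy a i) = Edge a b)) = Dummy a j) = i"
        using I by fastforce
      show "\<forall>b\<in>?D. (THE b'. m (Dummy a (THE i. m (Edge a b) = Dummy a i)) = Edge a b') = b"
        using D by fastforce
      show "(\<lambda>i. THE b. m (Dummy a i) = Edge a b) ` ?I \<subseteq> ?D"
        using I by fastforce
      show "(\<lambda>b. THE i. m (Edge a b) = Dummy a i) ` ?D \<subseteq> ?I"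
        using D by fastforce
    qed
    then have "card ?D = card ?I" by (simp add: bij_betw_same_card)
    also have "?I = {..<card (N a) - 2}" by auto
    finally have D: "card ?D = card (N a) - 2" by simp
    have "c a = N a - ?D"
    proof -
      have "b \<in> c a" if b: "b \<in> N a" "b \<notin> ?D" for b
      proof -
        have "Edge a b \<in> V" using a b by simp
        then have "gadj (Edge a b) (m (Edge a b))" by (rule m1)
        then show ?thesis using b by (cases "m (Edge a b)") (auto simp: c_def)
      qed
      then show ?thesis by (auto simp: c_def)
    qed
    then have "card (c a) = card (N a) - card ?D"
      using finN[OF a] by (simp add: card_Diff_subset)
    then show ?thesis using D degree_ge_2[OF a] by simp
  qed
  moreover have "card {a \<in> X. b \<in> c a} \<in> {0, 2}" for b
  proof (cases "\<exists>a\<in>X. b \<in> N a")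
    case False
    then have "{a \<in> X. b \<in> c a} = {}" by (auto simp: c_def)
    then show ?thesis by (simp only: card.empty) simp
  next
    case True
    then have V: "Port b i \<in> V" for i by simp
    have port_edge: "m (Edge a b) = Port b i \<longleftrightarrow> m (Port b i) = Edge a b" if "a \<in> X" "b \<in> N a" for a i
      using m1(2)[of "Edge a b"] m1(2)[of "Port b i"] V that by auto
    show ?thesis
    proof (cases "m (Port b True) = Port b False")
      case True
      then have "m (Port b False) = Port b True" using m1(2)[OF V, of True] by simp
      then have "m (Port b i) \<noteq> Edge a b" for i a using True by (cases i) auto
      then have "{a \<in> X. b \<in> c a} = {}" using port_edge by (auto simp: c_def)
      then show ?thesis by (simp only: card.empty) simp
    next
      case False
      then have "m (Port b False) \<noteq> Port b True" using m1(2)[OF V, of False] by auto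
      then have "\<exists>a\<in>X. b \<in> N a \<and> m (Port b i) = Edge a b" for i
        using False m1(1,3)[OF V, of i] by (cases "m (Port b i)"; cases i) auto
      then obtain f where f: "\<And>i. f i \<in> X \<and> b \<in> N (f i) \<and> m (Port b i) = Edge (f i) b"
        by metis
      have "f True \<noteq> f False"
        using f[of True] f[of False] m1(2)[OF V, of True] m1(2)[OF V, of False] by auto
      moreover have "{a \<in> X. b \<in> c a} = {f True, f False}"
      proof
        show "{a \<in> X. b \<in> c a} \<subseteq> {f True, f False}"
        proof
          fix a assume "a \<in> {a \<in> X. b \<in> c a}"
          then obtain i where "m (Port b i) = Edge a b" using port_edge by (auto simp: c_def)
          then show "a \<in> {f True, f False}" using f[of i] by (cases i) auto
        qed
        show "{f True, f False} \<subseteq> {a \<in> X. b \<in> c a}"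
          using f port_edge by (auto simp: c_def)
      qed
      ultimately show ?thesis by simp
    qed
  qed
  ultimately show ?thesis by (intro exI[of _ c]) (auto simp: c_def)
qed

end

lemma card_le_of_disjoint_hits:
  assumes "finite Q" "\<And>C. C \<in> F \<Longrightarrow> C \<inter> Q \<noteq> {}"
    and disj: "\<And>C D x. C \<in> F \<Longrightarrow> D \<in> F \<Longrightarrow> x \<in> C \<Longrightarrow> x \<in> D \<Longrightarrow> C = D"
  shows "card F \<le> card Q"
proof -
  define g where "g C = (SOME x. x \<in> C \<inter> Q)" for C
  have g: "g C \<in> C \<inter> Q" if "C \<in> F" for C
    unfolding g_def using assms(2)[OF that] by (rule some_in_eq[THEN iffD2])
  have "inj_on g F" using g disj by (metis IntD1 inj_onI)
  moreover have "g ` F \<subseteq> Q" using g by auto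
  ultimately show ?thesis using assms(1) card_inj_on_le by blast
qed

section \<open>Shape of a minimal barrier in the gadget graph\<close>

locale gadget_barrier = finite_double_hall X N for X :: "'a set" and N :: "'a \<Rightarrow> 'b set" +
  fixes U :: "('a, 'b) gadget set"
  assumes UV: "U \<subseteq> V"
    \<comment> \<open>This is what minimality of a barrier yields; being a barrier is then refuted
      by \<open>not_tutte_barrier\<close>.\<close>
    and three: "u \<in> U \<Longrightarrow> \<exists>x\<in>V - U. \<exists>y\<in>V - U. \<exists>z\<in>V - U. gadj u x \<and> gadj u y \<and> gadj u z \<and>
        (x, y) \<notin> joined gadj (V - U) \<and> (x, z) \<notin> joined gadj (V - U) \<and>
        (y, z) \<notin> joined gadj (V - U)"
begin

abbreviation "W \<equiv> V - U"
abbreviation "J \<equiv> joined gadj W"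

lemma J_step: "x \<in> W \<Longrightarrow> y \<in> W \<Longrightarrow> gadj x y \<Longrightarrow> (x, y) \<in> J"
  by (rule gadget.joined_adj)

lemma J_via: "x \<in> W \<Longrightarrow> y \<in> W \<Longrightarrow> z \<in> W \<Longrightarrow> gadj x y \<Longrightarrow> gadj y z \<Longrightarrow> (x, z) \<in> J"
  by (meson J_step gadget.joined_trans)

text \<open>\<open>Edge a b\<close> sees only dummies of \<open>a\<close> and the two ports of
  \<open>b\<close>. An edge vertex \<open>Edge a b'\<close> outside \<open>U\<close> would join all
  the dummies, and the ports are adjacent, so at most two components would be seen.\<close>

lemma edges_in_U:
  assumes "Edge a b \<in> U" "b' \<in> N a"
  shows "Edge a b' \<in> U"
proof (rule ccontr)
  assume "Edge a b' \<notin> U"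
  then have e: "Edge a b' \<in> W" using assms UV by auto
  obtain x y z where xyz: "x \<in> W" "y \<in> W" "z \<in> W"
    "gadj (Edge a b) x" "gadj (Edge a b) y" "gadj (Edge a b) z"
    "(x, y) \<notin> J" "(x, z) \<notin> J" "(y, z) \<notin> J"
    using three[OF assms(1)] by blast
  have same: "(v, w) \<in> J"
    if vw: "v \<in> W" "w \<in> W" "gadj (Edge a b) v" "gadj (Edge a b) w"
      "(\<exists>i. v = Dummy a i) \<longleftrightarrow> (\<exists>i. w = Dummy a i)" for v w
  proof (cases "\<exists>i. v = Dummy a i")
    case True
    then show ?thesis using that e by (intro J_via[of v "Edge a b'" w]) auto
  next
    case False
    then have "\<not> (\<exists>i. w = Dummy a i)" using vw(5) by blast
    then obtain j where j: "w = Port b j" using vw(4) by (cases w) auto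
    obtain i where "v = Port b i" using vw(3) False by (cases v) auto
    note ij = this j
    show ?thesis
      unfolding ij using vw(1,2)[unfolded ij] gadget.joined_refl J_step[of "Port b i" "Port b j"] by (cases "i = j") auto
  qed
  show False
    using same[of x y] same[of x z] same[of y z] xyz by blast
qed

lemma dummy_not_in_U: "Edge a b \<in> U \<Longrightarrow> Dummy a i \<notin> U"
proof
  assume e: "Edge a b \<in> U" "Dummy a i \<in> U"
  obtain x where x: "x \<in> W" "gadj (Dummy a i) x" using three[OF e(2)] by blast
  then obtain b' where "x = Edge a b'" by (cases x) auto
  then show False using edges_in_U[OF e(1), of b'] x by auto
qed

text \<open>A surviving port of \<open>b\<close> is adjacent to every edge vertex at
  \<open>b\<close>, hence would put everything the other port sees into one component.\<close>

lemma ports_in_U: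
  assumes "Port b i \<in> U"
  shows "Port b j \<in> U"
proof (rule ccontr)
  assume n: "Port b j \<notin> U"
  have w: "Port b j \<in> W" using n subsetD[OF UV assms] by simp
  have "i \<noteq> j" using n assms by blast
  have "(Port b j, v) \<in> J" if "v \<in> W" "gadj (Port b i) v" for v
    using that w \<open>i \<noteq> j\<close> J_step[of "Port b j" v] gadget.joined_refl by (cases v) auto
  moreover obtain x y where "x \<in> W" "y \<in> W" "gadj (Port b i) x" "gadj (Port b i) y" "(x, y) \<notin> J"
    using three[OF assms] by blast
  ultimately show False using gadget.joined_trans gadget.joined_sym by blast
qed

text \<open>Dummies of the same \<open>a\<close> have the same neighbours, so one left outside
  \<open>U\<close> would join everything another one sees.\<close>

lemma dummies_in_U:
  assumes "Dummy a i \<in> U" "Dummy a j \<in> V"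
  shows "Dummy a j \<in> U"
proof (rule ccontr)
  assume "Dummy a j \<notin> U"
  then have w: "Dummy a j \<in> W" using assms by blast
  obtain x y where xy: "x \<in> W" "y \<in> W" "gadj (Dummy a i) x" "gadj (Dummy a i) y" "(x, y) \<notin> J"
    using three[OF assms(1)] by blast
  then have "(x, y) \<in> J" using w by (intro J_via[of x "Dummy a j" y]) (cases x; cases y; auto)+
  then show False using xy by blast
qed

text \<open>The barrier consists of all edge vertices of \<open>SA\<close>, all dummies of \<open>T\<close> and all ports of \<open>SB\<close>;
  every odd component turns out to meet \<open>Q\<close>.\<close>

definition "SA = {a \<in> X. \<exists>b. Edge a b \<in> U}"
text \<open>An \<open>a\<close> of degree 2 outside \<open>SA\<close> has no dummies and belongs to
  \<open>T\<close> vacuously. Hence every \<open>a\<close> outside \<open>SA\<close> and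
  \<open>T\<close> keeps a dummy, and then all its gadget vertices, in \<open>W\<close>.\<close>

definition "T = {a \<in> X - SA. \<forall>i. Dummy a i \<in> V \<longrightarrow> Dummy a i \<in> U}"
definition "Bn = (\<Union>a\<in>X. N a)"
definition "SB = {b. Port b True \<in> U}"
definition "deg_T b = card {t \<in> T. b \<in> N t}"
text \<open>The elements of \<open>QD\<close> and \<open>QE\<close> are isolated in
  \<open>W\<close>, all their neighbours being in \<open>U\<close>. In \<open>QP\<close> one port
  stands for a block of two ports and \<open>deg_T b\<close> edge vertices, which is odd exactly
  when \<open>deg_T b\<close> is.\<close>

definition QD :: "('a, 'b) gadget set" where
  "QD = {Dummy a i | a i. a \<in> SA \<and> i + 2 < card (N a)}"
definition QE :: "('a, 'b) gadget set" where
  "QE = {Edge t b | t b. t \<in> T \<and> b \<in> SB \<and> b \<in> N t}"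
definition QP :: "('a, 'b) gadget set" where
  "QP = {Port b True | b. b \<in> Bn - SB \<and> odd (deg_T b)}"
definition "Q = QD \<union> QE \<union> QP"

lemma finite_sets: "finite U" "finite W" "finite SA" "finite T" "finite Bn" "finite SB"
proof -
  show "finite U" "finite W" using finite_V UV finite_subset by auto
  show "finite SA" "finite T" "finite Bn" using fin finN by (auto simp: SA_def T_def Bn_def)
  have "SB \<subseteq> Bn" using UV by (auto simp: SB_def Bn_def)
  then show "finite SB" using \<open>finite Bn\<close> finite_subset by blast
qed

lemma Q_subset_W: "Q \<subseteq> W"
proof -
  have "QD \<subseteq> W" using dummy_not_in_U by (auto simp: QD_def SA_def)
  moreover have "QE \<subseteq> W" by (auto simp: QE_def T_def SA_def)
  moreover have "QP \<subseteq> W" by (auto simp: QP_def Bn_def SB_def)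
  ultimately show ?thesis by (auto simp: Q_def)
qed

lemma neutral_in_W:
  assumes "a \<in> X - SA - T"
  shows "\<exists>i. Dummy a i \<in> W" "Dummy a j \<in> V \<Longrightarrow> Dummy a j \<in> W" "b \<in> N a \<Longrightarrow> Edge a b \<in> W"
proof -
  show "\<exists>i. Dummy a i \<in> W" using assms by (auto simp: T_def)
  then show "Dummy a j \<in> V \<Longrightarrow> Dummy a j \<in> W" using dummies_in_U by blast
  show "b \<in> N a \<Longrightarrow> Edge a b \<in> W" using assms by (auto simp: SA_def)
qed

text \<open>A component is the disjoint union of blocks: the gadget vertices of a single \<open>a \<notin> T\<close>, or the
  ports of a single \<open>b\<close> together with its edges to \<open>T\<close>.\<close>

fun blk :: "('a, 'b) gadget \<Rightarrow> 'a + 'b" where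
  "blk (Edge a b) = (if a \<in> T then Inr b else Inl a)"
| "blk (Dummy a i) = Inl a"
| "blk (Port b i) = Inr b"

text \<open>For \<open>a\<close> in \<open>SA\<close> only dummies survive, all in \<open>Q\<close>;
  for \<open>a\<close> in \<open>T\<close> the block is empty. Otherwise the block avoids
  \<open>Q\<close>, is connected and has \<open>card (N a) + (card (N a) - 2)\<close> vertices, an
  even number lying entirely inside or outside \<open>C\<close>.\<close>

lemma even_block_Inl:
  assumes C: "C = J `` {x}" "x \<in> W" and a: "a \<in> X"
  shows "even (card {v \<in> C. blk v = Inl a}) = even (card {v \<in> C \<inter> Q. blk v = Inl a})"
proof -
  have CW: "C \<subseteq> W" using C gadget.joined_in by auto
  have cl: "w \<in> C" if "v \<in> C" "(v, w) \<in> J" for v w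
    using that C gadget.joined_trans by blast
  consider "a \<in> SA" | "a \<in> T" | "a \<in> X - SA - T" using a by blast
  then show ?thesis
  proof cases
    case 1
    have "v \<in> Q" if "v \<in> C" "blk v = Inl a" for v
    proof (cases v)
      case (Edge a' b)
      then have "a' = a" using that by (auto split: if_splits)
      then have "v \<in> U" using Edge that CW 1 edges_in_U by (fastforce simp: SA_def)
      then show ?thesis using that CW by blast
    next
      case (Dummy a' i)
      then show ?thesis using that CW 1 by (auto simp: Q_def QD_def)
    qed (use that in auto)
    then have "{v \<in> C. blk v = Inl a} = {v \<in> C \<inter> Q. blk v = Inl a}" by blast
    then show ?thesis by simp
  next
    case 2
    have "blk v \<noteq> Inl a" if "v \<in> C" for v
      using that CW 2 by (cases v) (auto simp: T_def)
    then have "{v \<in> C. blk v = Inl a} = {}" "{v \<in> C \<inter> Q. blk v = Inl a} = {}" by blast+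
    then show ?thesis by (simp only:)
  next
    case 3
    define Z where "Z = Edge a ` N a \<union> Dummy a ` {..<card (N a) - 2}"
    have ZV: "v \<in> Z \<longleftrightarrow> v \<in> V \<and> blk v = Inl a" for v
      using 3 by (cases v) (auto simp: Z_def)
    have ZW: "Z \<subseteq> W" using 3 neutral_in_W[OF 3] by (auto simp: Z_def)
    obtain i where i: "Dummy a i \<in> W" using neutral_in_W(1)[OF 3] by blast
    have "N a \<noteq> {}" using degree_ge_2[OF a] by auto
    then obtain b where b: "b \<in> N a" by blast
    have jn: "(v, Dummy a i) \<in> J" if v: "v \<in> Z" for v
    proof -
      consider b' where "v = Edge a b'" | j where "v = Dummy a j" using v by (auto simp: Z_def)
      then show ?thesis
      proof cases
        case 1
        then show ?thesis using that ZW i by (intro J_step) auto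
      next
        case 2
        then show ?thesis
          using that ZW i neutral_in_W(3)[OF 3 b] by (intro J_via[of _ "Edge a b"]) auto
      qed
    qed
    have Zj: "(v, w) \<in> J" if "v \<in> Z" "w \<in> Z" for v w
      using jn[OF that(1)] jn[OF that(2)] gadget.joined_trans gadget.joined_sym by blast
    have CZ: "{v \<in> C. blk v = Inl a} = C \<inter> Z" using ZV CW by blast
    have "C \<inter> Z = {} \<or> C \<inter> Z = Z" using Zj cl by blast
    moreover have "even (card Z)"
    proof -
      have "card Z = card (Edge a ` N a) + card (Dummy a ` {..<card (N a) - 2} :: ('a, 'b) gadget set)"
        unfolding Z_def using finN[OF a] by (intro card_Un_disjoint) auto
      also have "\<dots> = card (N a) + (card (N a) - 2)"
        by (simp add: card_image inj_on_def)
      finally show ?thesis using degree_ge_2[OF a] by simp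
    qed
    ultimately have "even (card {v \<in> C. blk v = Inl a})" using CZ by (metis card.empty even_zero)
    moreover have "{v \<in> C \<inter> Q. blk v = Inl a} = {}"
      using 3 by (auto simp: Q_def QD_def QE_def QP_def)
    ultimately show ?thesis by (metis card.empty even_zero)
  qed
qed

text \<open>For \<open>b\<close> in \<open>SB\<close> only edge vertices to \<open>T\<close>
  survive, all in \<open>Q\<close>. Otherwise the block is connected through its ports, and
  \<open>QP\<close> was chosen to match its parity.\<close>

lemma even_block_Inr:
  assumes C: "C = J `` {x}" "x \<in> W" and b: "b \<in> Bn"
  shows "even (card {v \<in> C. blk v = Inr b}) = even (card {v \<in> C \<inter> Q. blk v = Inr b})"
proof -
  have CW: "C \<subseteq> W" using C gadget.joined_in by auto
  have cl: "w \<in> C" if "v \<in> C" "(v, w) \<in> J" for v w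
    using that C gadget.joined_trans by blast
  show ?thesis
  proof (cases "b \<in> SB")
    case True
    have "v \<in> Q" if "v \<in> C" "blk v = Inr b" for v
    proof (cases v)
      case (Edge t b')
      then have "t \<in> T" "b' = b" using that by (auto split: if_splits)
      then show ?thesis using that CW Edge True by (auto simp: Q_def QE_def)
    next
      case (Port b' i)
      then have "v \<in> U" using that True ports_in_U by (auto simp: SB_def)
      then show ?thesis using that CW by blast
    qed (use that in auto)
    then have "{v \<in> C. blk v = Inr b} = {v \<in> C \<inter> Q. blk v = Inr b}" by blast
    then show ?thesis by simp
  next
    case False
    define Z where "Z = {Port b True, Port b False} \<union> (\<lambda>t. Edge t b) ` {t \<in> T. b \<in> N t}"
    have ZV: "v \<in> Z \<longleftrightarrow> v \<in> V \<and> blk v = Inr b" for v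
      using b by (cases v) (auto simp: Z_def T_def Bn_def)
    have PW: "Port b i \<in> W" for i
      using False b ports_in_U by (auto simp: SB_def Bn_def)
    have ZW: "Z \<subseteq> W"
      using PW by (auto simp: Z_def T_def SA_def)
    have jn: "(v, Port b True) \<in> J" if "v \<in> Z" for v
    proof (cases "v = Port b True")
      case False
      then have "gadj v (Port b True)" using that by (auto simp: Z_def)
      then show ?thesis using that ZW PW by (intro J_step) auto
    qed (simp add: gadget.joined_refl)
    have Zj: "(v, w) \<in> J" if "v \<in> Z" "w \<in> Z" for v w
      using jn[OF that(1)] jn[OF that(2)] gadget.joined_trans gadget.joined_sym by blast
    have CZ: "{v \<in> C. blk v = Inr b} = C \<inter> Z" using ZV CW by blast
    have CQ: "{v \<in> C \<inter> Q. blk v = Inr b} = (if odd (deg_T b) then C \<inter> {Port b True} else {})"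
      using b False by (auto simp: Q_def QP_def QE_def QD_def split: if_splits)
    have cZ: "card Z = 2 + deg_T b"
    proof -
      have "card Z = card {Port b True, Port b False :: ('a, 'b) gadget} + card ((\<lambda>t. Edge t b) ` {t \<in> T. b \<in> N t})"
        unfolding Z_def using finite_sets by (intro card_Un_disjoint) auto
      then show ?thesis by (simp add: card_image inj_on_def deg_T_def)
    qed
    have P: "Port b True \<in> Z" by (simp add: Z_def)
    consider "C \<inter> Z = {}" | "C \<inter> Z = Z" using Zj cl by blast
    then show ?thesis
    proof cases
      case 1
      then have "{v \<in> C \<inter> Q. blk v = Inr b} = {}" unfolding CQ using P by auto
      then show ?thesis using CZ 1 by (simp only:)
    next
      case 2
      then have "C \<inter> {Port b True} = {Port b True}" using P by blast
      then show ?thesis unfolding CZ CQ 2 cZ by auto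
    qed
  qed
qed

lemma card_by_blk:
  assumes "S \<subseteq> W"
  shows "card S = (\<Sum>i\<in>blk ` V. card {v \<in> S. blk v = i})"
proof -
  have "finite S" using assms finite_sets finite_subset by blast
  then have "(\<Sum>i\<in>blk ` V. \<Sum>v\<in>{v \<in> S. blk v = i}. 1) = (\<Sum>v\<in>S. 1::nat)"
    using finite_V assms by (intro sum.group) auto
  then show ?thesis by simp
qed

lemma even_component:
  assumes "C = J `` {x}" "x \<in> W"
  shows "even (card C) = even (card (C \<inter> Q))"
proof -
  have CW: "C \<subseteq> W" using assms gadget.joined_in by auto
  have "even (card {v \<in> C. blk v = i}) = even (card {v \<in> C \<inter> Q. blk v = i})" if "i \<in> blk ` V" for i
  proof (cases i)
    case (Inl a)
    then have "a \<in> X" using that by (auto simp: V_def split: if_splits)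
    then show ?thesis using even_block_Inl[OF assms] Inl by blast
  next
    case (Inr b)
    then have "b \<in> Bn" using that by (auto simp: V_def Bn_def T_def split: if_splits)
    then show ?thesis using even_block_Inr[OF assms] Inr by blast
  qed
  then have "{i \<in> blk ` V. odd (card {v \<in> C. blk v = i})} =
      {i \<in> blk ` V. odd (card {v \<in> C \<inter> Q. blk v = i})}" by blast
  then show ?thesis
    using card_by_blk[OF CW] card_by_blk[of "C \<inter> Q"] CW finite_V
    by (simp add: even_sum_iff le_infI1)
qed

text \<open>The hitting set \<open>Q'\<close> is a parameter because, when \<open>T\<close> is a
  singleton and \<open>SA\<close>, \<open>SB\<close> are empty, two elements of \<open>Q\<close>
  must be saved.\<close>

lemma card_odd_comps_le:
  assumes "Q' \<subseteq> W" "\<And>C x. C = J `` {x} \<Longrightarrow> x \<in> W \<Longrightarrow> odd (card (C \<inter> Q)) \<Longrightarrow> C \<inter> Q' \<noteq> {}"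
  shows "card (odd_comps gadj W) \<le> card Q'"
proof (rule card_le_of_disjoint_hits)
  show "finite Q'" using assms(1) finite_sets finite_subset by blast
  show "C \<inter> Q' \<noteq> {}" if "C \<in> odd_comps gadj W" for C
    using that assms(2) even_component unfolding odd_comps_def by blast
  show "C = D" if "C \<in> odd_comps gadj W" "D \<in> odd_comps gadj W" "x \<in> C" "x \<in> D" for C D x
    using that gadget.joined_class_eq[of _ x W] unfolding odd_comps_def by blast
qed

section \<open>Counting the barrier against the hitting set\<close>

lemma sum_degrees_T: "(\<Sum>t\<in>T. card (N t)) = (\<Sum>b\<in>SB. deg_T b) + (\<Sum>b\<in>Bn - SB. deg_T b)"
proof -
  have "(\<Sum>t\<in>T. card (N t)) = (\<Sum>t\<in>T. \<Sum>b\<in>Bn. if b \<in> N t then 1 else 0)"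
  proof (rule sum.cong[OF refl])
    fix t assume "t \<in> T"
    then have "N t \<subseteq> Bn" by (auto simp: T_def Bn_def)
    then have "Bn \<inter> N t = N t" by blast
    then show "card (N t) = (\<Sum>b\<in>Bn. if b \<in> N t then 1 else 0)"
      using finite_sets by (simp add: sum.If_cases)
  qed
  also have "\<dots> = (\<Sum>b\<in>Bn. \<Sum>t\<in>T. if b \<in> N t then 1 else 0)" by (rule sum.swap)
  also have "\<dots> = (\<Sum>b\<in>Bn. deg_T b)"
    using finite_sets by (simp add: deg_T_def sum.If_cases Int_def)
  also have "\<dots> = (\<Sum>b\<in>SB. deg_T b) + (\<Sum>b\<in>Bn - SB. deg_T b)"
  proof -
    have "SB \<subseteq> Bn" using UV by (auto simp: SB_def Bn_def)
    then show ?thesis using finite_sets sum.subset_diff[of SB Bn deg_T] by simp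
  qed
  finally show ?thesis .
qed

lemma card_QE: "card QE = (\<Sum>b\<in>SB. deg_T b)"
proof -
  have "QE = (\<Union>b\<in>SB. (\<lambda>t. Edge t b) ` {t \<in> T. b \<in> N t})" by (auto simp: QE_def)
  then have "card QE = (\<Sum>b\<in>SB. card ((\<lambda>t. Edge t b) ` {t \<in> T. b \<in> N t}))"
    using finite_sets by (simp only:) (subst card_UN_disjoint; auto)
  then show ?thesis by (simp add: card_image inj_on_def deg_T_def)
qed

lemma card_QD: "card QD = (\<Sum>a\<in>SA. card (N a) - 2)"
proof -
  have "QD = (\<Union>a\<in>SA. Dummy a ` {..<card (N a) - 2})" by (auto simp: QD_def)
  then have "card QD = (\<Sum>a\<in>SA. card (Dummy a ` {..<card (N a) - 2} :: ('a, 'b) gadget set))"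
    using finite_sets by (simp only:) (subst card_UN_disjoint; auto)
  then show ?thesis by (simp add: card_image inj_on_def)
qed

lemma card_QP: "card QP = card {b \<in> Bn - SB. odd (deg_T b)}"
proof -
  have "QP = (\<lambda>b. Port b True) ` {b \<in> Bn - SB. odd (deg_T b)}" by (auto simp: QP_def)
  then show ?thesis by (simp add: card_image inj_on_def)
qed

lemma card_Q_le: "card Q \<le> (\<Sum>a\<in>SA. card (N a) - 2) + (\<Sum>b\<in>SB. deg_T b) +
    card {b \<in> Bn - SB. odd (deg_T b)}"
  unfolding Q_def
  using card_Un_le[of "QD \<union> QE" QP] card_Un_le[of QD QE] card_QD card_QE card_QP by linarith

lemma card_U_ge: "(\<Sum>a\<in>SA. card (N a)) + (\<Sum>t\<in>T. card (N t) - 2) + 2 * card SB \<le> card U"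
proof -
  define U1 where "U1 = (\<Union>a\<in>SA. Edge a ` N a)"
  define U2 where "U2 = (\<Union>t\<in>T. Dummy t ` {..<card (N t) - 2} :: ('a, 'b) gadget set)"
  define U3 where "U3 = (\<lambda>(b, i). Port b i :: ('a, 'b) gadget) ` (SB \<times> (UNIV :: bool set))"
  have "card U1 = (\<Sum>a\<in>SA. card (Edge a ` N a))"
    unfolding U1_def using finite_sets finN by (subst card_UN_disjoint) (auto simp: SA_def)
  then have c1: "card U1 = (\<Sum>a\<in>SA. card (N a))" by (simp add: card_image inj_on_def)
  have "card U2 = (\<Sum>t\<in>T. card (Dummy t ` {..<card (N t) - 2} :: ('a, 'b) gadget set))"
    unfolding U2_def using finite_sets by (subst card_UN_disjoint) auto
  then have c2: "card U2 = (\<Sum>t\<in>T. card (N t) - 2)" by (simp add: card_image inj_on_def)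
  have "card U3 = card (SB \<times> (UNIV :: bool set))"
    unfolding U3_def by (rule card_image) (auto simp: inj_on_def)
  then have c3: "card U3 = 2 * card SB" by (simp add: card_cartesian_product)
  have sub: "U1 \<subseteq> U" "U2 \<subseteq> U" "U3 \<subseteq> U"
    using edges_in_U ports_in_U by (auto simp: U1_def U2_def U3_def SA_def T_def SB_def)
  then have f: "finite U1" "finite U2" "finite U3" using finite_sets finite_subset by auto
  have "card (U1 \<union> U2 \<union> U3) = card (U1 \<union> U2) + card U3"
    using f by (intro card_Un_disjoint) (auto simp: U1_def U2_def U3_def)
  moreover have "card (U1 \<union> U2) = card U1 + card U2"
    using f by (intro card_Un_disjoint) (auto simp: U1_def U2_def)
  moreover have "card (U1 \<union> U2 \<union> U3) \<le> card U"
    using sub finite_sets by (intro card_mono) auto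
  ultimately show ?thesis using c1 c2 c3 by linarith
qed

lemma sum_minus_2: "S \<subseteq> X \<Longrightarrow> (\<Sum>a\<in>S. card (N a) - 2) + 2 * card S = (\<Sum>a\<in>S. card (N a))"
proof -
  assume S: "S \<subseteq> X"
  have "(\<Sum>a\<in>S. card (N a)) = (\<Sum>a\<in>S. (card (N a) - 2) + 2)"
    using S degree_ge_2 by (intro sum.cong) fastforce+
  then show ?thesis by (simp only: sum.distrib sum_constant) simp
qed

text \<open>Pointwise: degree 1 pays for its odd parity, degree 2 for the summand 2, and an odd
  degree from 3 on for both.\<close>

lemma odd_deg_le:
  "card {b \<in> Bn - SB. odd (deg_T b)} + 2 * card {b \<in> Bn - SB. 2 \<le> deg_T b} \<le> (\<Sum>b\<in>Bn - SB. deg_T b)"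
proof -
  let ?B = "Bn - SB"
  have "card {b \<in> ?B. odd (deg_T b)} + 2 * card {b \<in> ?B. 2 \<le> deg_T b} =
      (\<Sum>b\<in>?B. (if odd (deg_T b) then 1 else 0) + 2 * (if 2 \<le> deg_T b then 1 else 0))"
    using finite_sets by (simp add: sum.distrib sum.If_cases Int_def flip: sum_distrib_left)
  also have "\<dots> \<le> (\<Sum>b\<in>?B. deg_T b)"
  proof (rule sum_mono)
    fix b
    have "odd (deg_T b) \<Longrightarrow> 1 \<le> deg_T b" "odd (deg_T b) \<Longrightarrow> deg_T b \<noteq> 2"
      by (auto intro: Suc_leI odd_pos)
    then show "(if odd (deg_T b) then 1 else 0) + 2 * (if 2 \<le> deg_T b then 1 else 0) \<le> deg_T b"
      by auto
  qed
  finally show ?thesis .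
qed

text \<open>The counts combine to
  \<open>card U - card Q \<ge> 2 * (card SA + card SB + p - card T)\<close> over the integers, where
  \<open>p\<close> counts the \<open>b\<close> outside \<open>SB\<close> with
  \<open>deg_T b \<ge> 2\<close>. Every vertex linked to \<open>T\<close> is in \<open>SB\<close> or
  counted by \<open>p\<close>, so the double Hall property settles
  \<open>card T \<ge> 2\<close>.\<close>

lemma not_tutte_barrier: "card (odd_comps gadj W) \<le> card U"
proof -
  have le_Q: "card (odd_comps gadj W) \<le> card Q"
  proof (rule card_odd_comps_le[OF Q_subset_W])
    fix C :: "('a, 'b) gadget set" assume "odd (card (C \<inter> Q))"
    then show "C \<inter> Q \<noteq> {}" by (metis card.empty even_zero)
  qed
  have TX: "T \<subseteq> X" "SA \<subseteq> X" by (auto simp: T_def SA_def)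
  note eqs = card_Q_le card_U_ge sum_minus_2[OF TX(1)] sum_minus_2[OF TX(2)] sum_degrees_T odd_deg_le
  consider "2 \<le> card T" | "T = {}" | "card T = 1" 
    using finite_sets(4) card_0_eq[of T] by linarith
  then show ?thesis
  proof cases
    case 1
    have "linked N T \<subseteq> SB \<union> {b \<in> Bn - SB. 2 \<le> deg_T b}"
    proof
      fix b assume "b \<in> linked N T"
      then obtain a a' where a: "a \<in> T" "a' \<in> T" "a \<noteq> a'" "b \<in> N a" "b \<in> N a'"
        by (auto simp: linked_def)
      then have "card {a, a'} \<le> deg_T b"
        unfolding deg_T_def using finite_sets by (intro card_mono) auto
      then show "b \<in> SB \<union> {b \<in> Bn - SB. 2 \<le> deg_T b}"
        using a TX by (auto simp: Bn_def)
    qed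
    then have "card (linked N T) \<le> card (SB \<union> {b \<in> Bn - SB. 2 \<le> deg_T b})"
      using finite_sets by (intro card_mono) auto
    also have "\<dots> \<le> card SB + card {b \<in> Bn - SB. 2 \<le> deg_T b}" by (rule card_Un_le)
    finally have "card T \<le> card SB + card {b \<in> Bn - SB. 2 \<le> deg_T b}"
      using double_hall[OF TX(1) 1] by linarith
    then show ?thesis using le_Q eqs by linarith
  next
    case 2
    then have "deg_T b = 0" for b by (simp add: deg_T_def)
    then have "card Q \<le> (\<Sum>a\<in>SA. card (N a) - 2)" using card_Q_le by simp
    then show ?thesis using le_Q eqs by linarith
  next
    case 3
    show ?thesis
    proof (cases "SA = {} \<and> SB = {}")
      case False
      then have "1 \<le> card SA + card SB" 
        using finite_sets by (metis One_nat_def Suc_leI add_gr_0 card_gt_0_iff)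
      then show ?thesis using le_Q eqs 3 by linarith
    next
      case True
      \<comment> \<open>Here the bound is short by two. Any other \<open>a\<close> shares two
        neighbours \<open>b1\<close>, \<open>b2\<close> with \<open>t\<close>; their ports both lie
        in \<open>Q\<close> and are joined through the gadget of \<open>a\<close>. A component
        meeting \<open>Q\<close> only in these two ports is even, so \<open>Q\<close> without them
        still meets every odd component.\<close>
      obtain t where t: "T = {t}" using 3 by (auto simp: card_1_singleton_iff)
      then have tX: "t \<in> X" using TX by auto
      have "X \<noteq> {t}" using two by auto
      then obtain a where a: "a \<in> X" "a \<noteq> t" using tX by blast
      have "2 \<le> card (N t \<inter> N a)" using common_neighbours tX a by blast
      then obtain b1 b2 where b: "b1 \<in> N t \<inter> N a" "b2 \<in> N t \<inter> N a" "b1 \<noteq> b2"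
        by (metis card_2_iff insert_subset obtain_subset_with_card_n)
      let ?p1 = "Port b1 True" and ?p2 = "Port b2 True"
      have deg: "deg_T b' = 1" if "b' \<in> N t" for b'
      proof -
        have "{s \<in> T. b' \<in> N s} = {t}" using t that by auto
        then show ?thesis by (simp add: deg_T_def)
      qed
      have pQ: "{?p1, ?p2} \<subseteq> Q"
        using b deg tX True by (auto simp: Q_def QP_def Bn_def)
      have na: "a \<in> X - SA - T" using a True t by auto
      obtain i where i: "Dummy a i \<in> W" using neutral_in_W(1)[OF na] by blast
      have step: "(Port b' True, Dummy a i) \<in> J" if "b' \<in> N t \<inter> N a" "Port b' True \<in> Q" for b'
        using that i neutral_in_W(3)[OF na, of b'] Q_subset_W
        by (intro J_via[of _ "Edge a b'"]) auto
      have p12: "(?p1, ?p2) \<in> J"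
        using step[of b1] step[of b2] b pQ gadget.joined_sym gadget.joined_trans
        by (meson insert_subset)
      have "card (odd_comps gadj W) \<le> card (Q - {?p1, ?p2})"
      proof (rule card_odd_comps_le)
        show "Q - {?p1, ?p2} \<subseteq> W" using Q_subset_W by blast
        fix C x assume C: "C = J `` {x}" and odd: "odd (card (C \<inter> Q))"
        have iff: "?p1 \<in> C \<longleftrightarrow> ?p2 \<in> C"
          using p12 C gadget.joined_sym gadget.joined_trans by blast
        show "C \<inter> (Q - {?p1, ?p2}) \<noteq> {}"
        proof
          assume "C \<inter> (Q - {?p1, ?p2}) = {}"
          then have "C \<inter> Q = {} \<or> C \<inter> Q = {?p1, ?p2}" using iff pQ by blast
          then have "card (C \<inter> Q) = 0 \<or> card (C \<inter> Q) = 2"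
            using b(3) by (elim disjE) simp_all
          then show False using odd by (elim disjE) (simp_all only: even_zero even_numeral not_True_eq_False)
        qed
      qed
      also have "card (Q - {?p1, ?p2}) = card Q - 2"
      proof -
        have "finite Q" using Q_subset_W finite_sets finite_subset by blast
        then show ?thesis using pQ b(3) by (simp add: card_Diff_subset)
      qed
      finally have le: "card (odd_comps gadj W) \<le> card Q - 2" .
      have "card Q \<le> card U + 2" using eqs 3 by linarith
      then show ?thesis using le by simp
    qed
  qed
qed

end

lemma finite_double_hall_two_factor:
  assumes "finite_double_hall X N"
  shows "\<exists>c. (\<forall>a\<in>X. c a \<subseteq> N a \<and> card (c a) = 2) \<and> (\<forall>b. card {a \<in> X. b \<in> c a} \<in> {0, 2})"
proof -
  interpret finite_double_hall X N by (rule assms)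
  show ?thesis
  proof (cases rule: gadget.perfect_matching_or_barrier[OF finite_V])
    case (1 m)
    then show ?thesis by (rule two_factor_of_perfect_matching)
  next
    case (2 U)
    then interpret gadget_barrier X N U
      by unfold_locales auto
    show ?thesis using not_tutte_barrier 2(2) by simp
  qed
qed

section \<open>Infinite double Hall graphs\<close>

text \<open>Compactness by repeated pigeonhole: the infinite set of indices agreeing on the first
  \<open>k\<close> coordinates is thinned so that coordinate \<open>k\<close> is constant
  too.\<close>

lemma finite_range_limit:
  fixes f :: "nat \<Rightarrow> nat \<Rightarrow> 'b"
  assumes fin: "\<And>i. finite (range (\<lambda>n. f n i))"
  shows "\<exists>g. \<forall>k. infinite {n. \<forall>i<k. f n i = g i}"
proof -
  have "\<exists>h. \<forall>k. infinite {n. \<forall>i<k. f n i = h k i} \<and> (\<forall>i<k. h (Suc k) i = h k i)"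
  proof (rule dependent_nat_choice)
    show "\<exists>h. infinite {n. \<forall>i<0. f n i = h i}" by simp
    fix h k assume inf: "infinite {n. \<forall>i<k. f n i = h i}" (is "infinite ?S")
    have "finite ((\<lambda>n. f n k) ` ?S)" using fin[of k] by (rule finite_subset[rotated]) blast
    then obtain n0 where n0: "infinite {n \<in> ?S. f n k = f n0 k}"
      using pigeonhole_infinite[OF inf] by blast
    have "{n \<in> ?S. f n k = f n0 k} \<subseteq> {n. \<forall>i<Suc k. f n i = (h(k := f n0 k)) i}"
      by (auto simp: less_Suc_eq)
    then have "infinite {n. \<forall>i<Suc k. f n i = (h(k := f n0 k)) i}"
      using n0 finite_subset by blast
    then show "\<exists>h'. infinite {n. \<forall>i<Suc k. f n i = h' i} \<and> (\<forall>i<k. h' i = h i)"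
      by (intro exI[of _ "h(k := f n0 k)"]) simp
  qed
  then obtain h where h: "\<And>k. infinite {n. \<forall>i<k. f n i = h k i}"
    and ext: "\<And>k i. i < k \<Longrightarrow> h (Suc k) i = h k i" by blast
  have stable: "h k i = h (Suc i) i" if "Suc i \<le> k" for i k
    using that by (induction k rule: dec_induct) (auto simp: ext)
  have "infinite {n. \<forall>i<k. f n i = h (Suc i) i}" for k
  proof -
    have "{n. \<forall>i<k. f n i = h (Suc i) i} = {n. \<forall>i<k. f n i = h k i}"
      using stable[of _ k] by (metis Suc_leI)
    then show ?thesis using h[of k] by argo
  qed
  then show ?thesis by (intro exI[of _ "\<lambda>i. h (Suc i) i"] allI)
qed

section \<open>Countability and limits of finite factors\<close>

locale infinite_double_hall =
  fixes A :: "'a set" and N :: "'a \<Rightarrow> 'b set"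
  assumes infinite_A: "infinite A"
    and finite_N: "a \<in> A \<Longrightarrow> finite (N a)"
    and double_hall: "T \<subseteq> A \<Longrightarrow> finite T \<Longrightarrow> 2 \<le> card T \<Longrightarrow> card T \<le> card (linked N T)"
begin

text \<open>Otherwise infinitely many vertices of bounded degree contain arbitrarily large finite sets whose
  neighbourhoods pairwise meet in one and the same set \<open>K\<close>, violating the double Hall property.\<close>

lemma finite_bounded_degree: "finite {a \<in> A. card (N a) \<le> d}"
proof (rule ccontr)
  define Y where "Y = {a \<in> A. card (N a) \<le> d}"
  assume "infinite {a \<in> A. card (N a) \<le> d}"
  then have Y: "infinite Y" by (simp add: Y_def)
  let ?P = "\<lambda>K. infinite {a \<in> Y. K \<subseteq> N a}"
  have bound: "finite K \<and> card K \<le> d" if P: "?P K" for K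
  proof -
    have "{a \<in> Y. K \<subseteq> N a} \<noteq> {}" using P by (metis (no_types, lifting) finite.emptyI)
    then obtain a where a: "a \<in> A" "card (N a) \<le> d" "K \<subseteq> N a" by (auto simp: Y_def)
    then show ?thesis
      using finite_N[OF a(1)] card_mono[of "N a" K] finite_subset[of K "N a"] by simp
  qed
  \<comment> \<open>A largest \<open>K\<close> contained in infinitely many neighbourhoods. By
    maximality each \<open>b\<close> outside \<open>K\<close> lies in only finitely many
    neighbourhoods of \<open>Z\<close>, so a greedy choice avoids all intersections outside
    \<open>K\<close>.\<close>
  have "\<exists>K. ?P K \<and> (\<forall>K'. ?P K' \<longrightarrow> card K' \<le> card K)"
    using bound Y by (intro ex_has_greatest_nat[of ?P "{}" card "Suc d"]) (auto simp: less_Suc_eq_le)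
  then obtain K where K: "?P K" and greatest: "\<And>K'. ?P K' \<Longrightarrow> card K' \<le> card K" by blast
  define Z where "Z = {a \<in> Y. K \<subseteq> N a}"
  have Z: "infinite Z" "Z \<subseteq> A" using K by (auto simp: Z_def Y_def)
  have rare: "finite {a \<in> Z. b \<in> N a}" if "b \<notin> K" for b
  proof (rule ccontr)
    assume "infinite {a \<in> Z. b \<in> N a}"
    moreover have "{a \<in> Z. b \<in> N a} = {a \<in> Y. insert b K \<subseteq> N a}" by (auto simp: Z_def)
    ultimately have "card (insert b K) \<le> card K" using greatest by simp
    then show False using bound[OF K] that by simp
  qed
  have "\<exists>X\<subseteq>Z. finite X \<and> card X = n \<and> (\<forall>a\<in>X. \<forall>a'\<in>X. a \<noteq> a' \<longrightarrow> N a \<inter> N a' \<subseteq> K)" for n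
  proof (induction n)
    case 0 then show ?case by (intro exI[of _ "{}"]) simp
  next
    case (Suc n)
    then obtain X where X: "X \<subseteq> Z" "finite X" "card X = n"
      and dis: "\<And>a a'. a \<in> X \<Longrightarrow> a' \<in> X \<Longrightarrow> a \<noteq> a' \<Longrightarrow> N a \<inter> N a' \<subseteq> K" by blast
    let ?bad = "X \<union> (\<Union>x\<in>X. \<Union>b\<in>N x - K. {a \<in> Z. b \<in> N a})"
    have "finite (N x)" if "x \<in> X" for x using that X Z finite_N by blast
    then have "finite ?bad" using X rare by auto
    then obtain a where a: "a \<in> Z" "a \<notin> ?bad"
      using Z by (meson finite_subset subsetI)
    then have "N a \<inter> N x \<subseteq> K" if "x \<in> X" for x using that by blast
    then show ?case
      using a X dis by (intro exI[of _ "insert a X"]) (auto simp: Int_commute)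
  qed
  \<comment> \<open>\<open>d + 2\<close> exceeds \<open>card K \<le> d\<close> and is at least 2
    even for \<open>d = 0\<close>.\<close>
  then obtain X where X: "X \<subseteq> Z" "finite X" "card X = d + 2"
    and dis: "\<And>a a'. a \<in> X \<Longrightarrow> a' \<in> X \<Longrightarrow> a \<noteq> a' \<Longrightarrow> N a \<inter> N a' \<subseteq> K" by metis
  have "card X \<le> card (linked N X)" using X Z by (intro double_hall) auto
  also have "linked N X \<subseteq> K" using dis by (auto simp: linked_def)
  then have "card (linked N X) \<le> card K" using bound[OF K] card_mono by blast
  finally show False using X bound[OF K] by simp
qed

lemma countable_A: "countable A"
proof -
  have "countable (\<Union>d. {a \<in> A. card (N a) \<le> d})"
    using finite_bounded_degree by (intro countable_UN) (auto intro: countable_finite)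
  moreover have "(\<Union>d. {a \<in> A. card (N a) \<le> d}) = A" by auto
  ultimately show ?thesis by (simp only:)
qed

definition holders :: "('a \<Rightarrow> 'b set) \<Rightarrow> 'b \<Rightarrow> 'a set" where
  "holders c b = {a \<in> A. b \<in> c a}"

text \<open>\<open>holders N b\<close> is the neighbourhood of \<open>b\<close> in \<open>A\<close>,
  so its finiteness expresses finite degree; deficiency is tolerated only at infinite
  degree.\<close>

definition almost_factor :: "('a \<Rightarrow> 'b set) \<Rightarrow> bool" where
  "almost_factor c \<longleftrightarrow> (\<forall>a\<in>A. c a \<subseteq> N a \<and> card (c a) = 2) \<and>
     (\<forall>b. finite (holders c b) \<and> card (holders c b) \<le> 2 \<and>
        (finite (holders N b) \<longrightarrow> card (holders c b) \<in> {0, 2}))"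

text \<open>Each \<open>a\<close> has finitely many possible pairs, so finite factors have a limit
  agreeing with some of them on any given finite set. Upper bounds on holders pass to the limit by
  testing finite subsets.\<close>

lemma almost_factor_exists: "\<exists>c. almost_factor c"
proof -
  define e where "e = from_nat_into A"
  have e: "bij_betw e UNIV A"
    unfolding e_def using bij_betw_from_nat_into countable_A infinite_A by blast
  then have inj: "inj e" and eA: "range e = A" by (auto simp: bij_betw_def)
  \<comment> \<open>The offset 2 gives the first finite part the two vertices it must have.\<close>
  define X where "X n = e ` {..<n + 2}" for n
  have "\<exists>c. (\<forall>a\<in>X n. c a \<subseteq> N a \<and> card (c a) = 2) \<and> (\<forall>b. card {a \<in> X n. b \<in> c a} \<in> {0, 2})" for n
  proof (rule finite_double_hall_two_factor)
    have XA: "X n \<subseteq> A" using eA by (auto simp: X_def)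
    have "finite (X n)" by (simp add: X_def)
    moreover have "card (X n) = n + 2"
      unfolding X_def using inj by (subst card_image) (auto intro: inj_on_subset)
    ultimately show "finite_double_hall (X n) N"
      using XA finite_N double_hall finite_subset[of _ "X n"]
      by unfold_locales (auto dest: order_trans)
  qed
  then obtain F where F: "\<And>n a. a \<in> X n \<Longrightarrow> F n a \<subseteq> N a \<and> card (F n a) = 2"
    and Fb: "\<And>n b. card {a \<in> X n. b \<in> F n a} \<in> {0, 2}" by metis
  define f where "f n i = (if i < n + 2 then F n (e i) else {})" for n i
  have "finite (range (\<lambda>n. f n i))" for i
  proof (rule finite_subset)
    show "range (\<lambda>n. f n i) \<subseteq> Pow (N (e i))" using F by (auto simp: f_def X_def)
    show "finite (Pow (N (e i)))" using finite_N eA by auto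
  qed
  then obtain g where g: "\<And>k. infinite {n. \<forall>i<k. f n i = g i}"
    using finite_range_limit[of f] by blast
  define c where "c a = g (inv e a)" for a
  have ce: "c (e i) = g i" for i using inj by (simp add: c_def)
  have approx: "\<exists>n. Y \<subseteq> X n \<and> (\<forall>a\<in>Y. F n a = c a)" if Y: "Y \<subseteq> A" "finite Y" for Y
  proof -
    obtain I where I: "finite I" "Y = e ` I"
      using Y eA by (metis finite_subset_image)
    then obtain k where k: "I \<subseteq> {..<k}" using finite_nat_iff_bounded by blast
    obtain n where n: "k \<le> n" "\<forall>i<k. f n i = g i"
      using g[of k] unfolding infinite_nat_iff_unbounded_le by blast
    have "Y \<subseteq> X n" using I k n by (auto simp: X_def)
    moreover have "F n (e i) = c (e i)" if "i \<in> I" for i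
    proof -
      have "i < k" using that k by blast
      then show ?thesis using n ce by (auto simp: f_def)
    qed
    ultimately show ?thesis using I by blast
  qed
  have cN: "c a \<subseteq> N a \<and> card (c a) = 2" if "a \<in> A" for a
    using approx[of "{a}"] F that by fastforce
  moreover have "finite (holders c b) \<and> card (holders c b) \<le> 2" for b
  proof (rule finite_if_finite_subsets_card_bdd)
    fix Y assume Y: "Y \<subseteq> holders c b" "finite Y"
    then obtain n where n: "Y \<subseteq> X n" "\<forall>a\<in>Y. F n a = c a"
      using approx[of Y] by (auto simp: holders_def)
    then have "card Y \<le> card {a \<in> X n. b \<in> F n a}"
      using Y by (intro card_mono) (auto simp: holders_def X_def)
    then show "card Y \<le> 2" using Fb[of n b] by auto
  qed
  moreover have "card (holders c b) \<in> {0, 2}" if finb: "finite (holders N b)" for b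
  proof -
    \<comment> \<open>All neighbours of \<open>b\<close> lie in one part \<open>X n\<close>, so the
      limit and the \<open>n\<close>-th factor have the same holders of \<open>b\<close> and the
      exact count is inherited.\<close>
    obtain n where n: "holders N b \<subseteq> X n" "\<forall>a\<in>holders N b. F n a = c a"
      using approx[OF _ finb] by (auto simp: holders_def)
    have XA: "X n \<subseteq> A" using eA by (auto simp: X_def)
    have "holders c b = {a \<in> X n. b \<in> F n a}"
    proof
      show "holders c b \<subseteq> {a \<in> X n. b \<in> F n a}"
      proof
        fix a assume "a \<in> holders c b"
        moreover then have "a \<in> holders N b" using cN by (auto simp: holders_def)
        ultimately show "a \<in> {a \<in> X n. b \<in> F n a}" using n by (auto simp: holders_def)
      qed
      show "{a \<in> X n. b \<in> F n a} \<subseteq> holders c b"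
      proof
        fix a assume a: "a \<in> {a \<in> X n. b \<in> F n a}"
        then have "a \<in> holders N b" using F XA by (auto simp: holders_def)
        then show "a \<in> holders c b" using n a by (auto simp: holders_def)
      qed
    qed
    then show ?thesis using Fb by simp
  qed
  ultimately show ?thesis unfolding almost_factor_def by blast
qed

text \<open>A deficient \<open>b\<close> takes \<open>a\<close> over from \<open>d\<close>, which
  has infinite degree and may become deficient. The last two clauses, that other vertices only lose
  holders and that a settled \<open>b\<close> causes no change, are what keeps settled vertices
  settled later.\<close>

lemma repair_step:
  assumes c: "almost_factor c" and P: "finite P"
    and few: "finite {b. holders N b \<noteq> {} \<and> finite (holders N b)}"
  shows "\<exists>c'. almost_factor c' \<and> card (holders c' b) \<in> {0, 2} \<and> (\<forall>a\<in>P. c' a = c a) \<and>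
    (\<forall>b'. b' \<noteq> b \<longrightarrow> holders c' b' \<subseteq> holders c b') \<and> (card (holders c b) \<in> {0, 2} \<longrightarrow> c' = c)"
proof (cases "card (holders c b) \<in> {0, 2}")
  case True
  then show ?thesis using c by blast
next
  case False
  have c2: "c a \<subseteq> N a" "card (c a) = 2" if "a \<in> A" for a
    using c that by (auto simp: almost_factor_def)
  have h: "finite (holders c b')" "card (holders c b') \<le> 2"
    "finite (holders N b') \<Longrightarrow> card (holders c b') \<in> {0, 2}" for b'
    using c by (auto simp: almost_factor_def)
  have one: "card (holders c b) = 1" using h(2)[of b] False by auto
  have inf: "infinite (holders N b)" using h(3)[of b] False by blast
  \<comment> \<open>Excluded are frozen vertices, neighbours of finite-degree vertices, whose
    partners could not be robbed, and vertices already holding \<open>b\<close>.\<close>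
  define R where "R = P \<union> \<Union> (holders N ` {b. holders N b \<noteq> {} \<and> finite (holders N b)}) \<union> holders c b"
  have "finite R" using P few h by (auto simp: R_def)
  then obtain a where a: "a \<in> holders N b" "a \<notin> R" using inf by (meson finite_subset subsetI)
  have aA: "a \<in> A" "b \<in> N a" "a \<notin> P" "b \<notin> c a" using a by (auto simp: holders_def R_def)
  obtain d where d: "d \<in> c a" using c2(2)[OF aA(1)] by (metis card.empty ex_in_conv zero_neq_numeral)
  have db: "d \<noteq> b" using d aA by blast
  have "a \<in> holders N d" using d c2[OF aA(1)] aA by (auto simp: holders_def)
  then have infd: "infinite (holders N d)" using a(2) unfolding R_def by blast
  define c' where "c' = c(a := insert b (c a - {d}))"
  have fc: "finite (c a)" using c2[OF aA(1)] by (metis card.infinite zero_neq_numeral)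
  have hb: "holders c' b = insert a (holders c b)"
    using aA by (auto simp: holders_def c'_def)
  have hd: "holders c' d = holders c d - {a}" using db by (auto simp: holders_def c'_def)
  have ho: "holders c' b' = holders c b'" if "b' \<noteq> b" "b' \<noteq> d" for b'
    using that by (auto simp: holders_def c'_def)
  have two: "card (holders c' b) = 2"
    using hb h one aA by (simp add: holders_def)
  have "almost_factor c'"
    unfolding almost_factor_def
  proof (intro conjI ballI allI)
    fix a' assume a': "a' \<in> A"
    show "c' a' \<subseteq> N a'" using c2[OF a'] aA d by (auto simp: c'_def)
    have "card (insert b (c a - {d})) = 2"
      using fc d aA c2[OF aA(1)] by simp
    then show "card (c' a') = 2" using c2[OF a'] by (simp add: c'_def)
  next
    fix b'
    consider "b' = b" | "b' = d" | "b' \<noteq> b" "b' \<noteq> d" by blast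
    then have "finite (holders c' b') \<and> card (holders c' b') \<le> 2 \<and>
        (finite (holders N b') \<longrightarrow> card (holders c' b') \<in> {0, 2})"
    proof cases
      case 1 then show ?thesis using hb h two by simp
    next
      case 2
      have "card (holders c d - {a}) \<le> card (holders c d)" using h by (intro card_mono) auto
      then show ?thesis using 2 hd h[of d] infd by auto
    next
      case 3 then show ?thesis using ho h by simp
    qed
    then show "finite (holders c' b')" "card (holders c' b') \<le> 2"
      "finite (holders N b') \<longrightarrow> card (holders c' b') \<in> {0, 2}" by blast+
  qed
  moreover have "\<forall>a'\<in>P. c' a' = c a'" using aA by (auto simp: c'_def)
  moreover have "holders c' b' \<subseteq> holders c b'" if "b' \<noteq> b" for b'
    using that hd ho by (cases "b' = d") auto
  ultimately show ?thesis using two False by blast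
qed

text \<open>The deficiency of each \<open>b\<close> of infinite degree held only once is passed on along a ray and so
  pushed to infinity; vertices are frozen once their final state is reached.\<close>

lemma two_factor_exists:
  assumes few: "finite {b. holders N b \<noteq> {} \<and> finite (holders N b)}"
  shows "\<exists>c. (\<forall>a\<in>A. c a \<subseteq> N a \<and> card (c a) = 2) \<and>
    (\<forall>b. holders c b \<noteq> {} \<longrightarrow> card (holders c b) = 2)"
proof -
  define ea where "ea = from_nat_into A"
  define eb where "eb = from_nat_into (\<Union>a\<in>A. N a)"
  have ea: "range ea = A"
    unfolding ea_def using range_from_nat_into infinite_A countable_A by (metis finite.emptyI)
  \<comment> \<open>The premise only provides nonemptiness of the enumerated set.\<close>
  have NB: "range eb = (\<Union>a\<in>A. N a)" if "b \<in> (\<Union>a\<in>A. N a)" for b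
  proof -
    have "countable (\<Union>a\<in>A. N a)" using countable_A finite_N by (auto intro: countable_finite)
    then show ?thesis unfolding eb_def using that by (intro range_from_nat_into) auto
  qed
  \<comment> \<open>A state is the current choice together with the finite set of frozen vertices;
    step \<open>k\<close> settles \<open>eb k\<close>, then freezes \<open>ea k\<close> and the
    holders of \<open>eb k\<close>.\<close>
  define I where "I k s \<longleftrightarrow> almost_factor (fst s) \<and> finite (snd s)" 
    for k :: nat and s :: "('a \<Rightarrow> 'b set) \<times> 'a set"
  define S where "S k s s' \<longleftrightarrow> card (holders (fst s') (eb k)) \<in> {0, 2} \<and>
      (\<forall>a\<in>snd s. fst s' a = fst s a) \<and>
      (\<forall>b'. b' \<noteq> eb k \<longrightarrow> holders (fst s') b' \<subseteq> holders (fst s) b') \<and>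
      (card (holders (fst s) (eb k)) \<in> {0, 2} \<longrightarrow> fst s' = fst s) \<and>
      snd s' = snd s \<union> {ea k} \<union> holders (fst s') (eb k)" for k s s'
  have "\<exists>s. \<forall>k. I k (s k) \<and> S k (s k) (s (Suc k))"
  proof (rule dependent_nat_choice)
    obtain c where "almost_factor c" using almost_factor_exists by blast
    then show "\<exists>s. I 0 s" by (intro exI[of _ "(c, {})"]) (simp add: I_def)
    fix s k assume "I k s"
    then have s: "almost_factor (fst s)" "finite (snd s)" by (auto simp: I_def)
    obtain c' where c': "almost_factor c'" "card (holders c' (eb k)) \<in> {0, 2}"
      "\<forall>a\<in>snd s. c' a = fst s a" "\<forall>b'. b' \<noteq> eb k \<longrightarrow> holders c' b' \<subseteq> holders (fst s) b'"
      "card (holders (fst s) (eb k)) \<in> {0, 2} \<longrightarrow> c' = fst s"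
      using repair_step[OF s few, of "eb k"] by blast
    have "finite (holders c' (eb k))" using c'(1) by (simp add: almost_factor_def)
    then show "\<exists>s'. I (Suc k) s' \<and> S k s s'"
      using c' s by (intro exI[of _ "(c', snd s \<union> {ea k} \<union> holders c' (eb k))"]) (auto simp: I_def S_def)
  qed
  then obtain s where Is: "\<And>k. I k (s k)" and Ss: "\<And>k. S k (s k) (s (Suc k))" by blast
  define C P where "C k = fst (s k)" and "P k = snd (s k)" for k
  have C: "almost_factor (C k)" for k
    using Is[of k] by (simp add: I_def C_def)
  have even: "card (holders (C (Suc k)) (eb k)) \<in> {0, 2}" for k
    using Ss[of k] unfolding S_def C_def by (elim conjE)
  have frozen: "C (Suc k) a = C k a" if "a \<in> P k" for k a
    using Ss[of k] that unfolding S_def C_def P_def by (elim conjE) (rule bspec)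
  have shrink: "holders (C (Suc k)) b \<subseteq> holders (C k) b" if "b \<noteq> eb k" for k b
    using Ss[of k] that unfolding S_def C_def by (elim conjE) simp
  have same: "C (Suc k) = C k" if "card (holders (C k) (eb k)) \<in> {0, 2}" for k
    using Ss[of k] that unfolding S_def C_def by (elim conjE) (rule mp)
  have P: "P (Suc k) = P k \<union> {ea k} \<union> holders (C (Suc k)) (eb k)" for k
    using Ss[of k] unfolding S_def C_def P_def by (elim conjE)
  have "P k \<subseteq> P (Suc k)" for k unfolding P[of k] by blast
  then have Pmono: "P k \<subseteq> P j" if "k \<le> j" for k j
    using that by (rule lift_Suc_mono_le)
  have Cfrozen: "C j a = C k a" if "k \<le> j" "a \<in> P k" for k j a
    using that(1)
  proof (induction j rule: dec_induct)
    case (step j)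
    then show ?case using frozen[of a j] Pmono[of k j] that(2) by auto
  qed simp
  \<comment> \<open>If the enumeration \<open>eb\<close> returns to the same vertex, it is already
    settled and nothing changes. Any other step can only remove holders, and these are
    frozen.\<close>
  have Hfinal: "holders (C j) (eb k) = holders (C (Suc k)) (eb k)" if "Suc k \<le> j" for k j
    using that
  proof (induction j rule: dec_induct)
    case (step j)
    show ?case
    proof (cases "eb j = eb k")
      case True
      then have "C (Suc j) = C j" using same[of j] step.IH even[of k] by simp
      then show ?thesis using step.IH by simp
    next
      case False
      have "holders (C j) (eb k) \<subseteq> holders (C (Suc j)) (eb k)"
      proof
        fix a assume a: "a \<in> holders (C j) (eb k)"
        then have "a \<in> P (Suc k)" using step.IH P by blast
        then have "a \<in> P j" using Pmono step.hyps by blast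
        then show "a \<in> holders (C (Suc j)) (eb k)" using frozen a by (simp add: holders_def)
      qed
      then show ?thesis using shrink[of "eb k" j] False step.IH by auto
    qed
  qed simp
  \<comment> \<open>\<open>a\<close> is frozen in the step whose index enumerates it, so its choice
    is final from the next stage on.\<close>
  define c where "c a = C (Suc (SOME i. ea i = a)) a" for a
  have c: "\<exists>i. \<forall>j\<ge>i. C j a = c a" if "a \<in> A" for a
  proof -
    define i where "i = (SOME i. ea i = a)"
    have "ea i = a" unfolding i_def using that ea by (metis (mono_tags, lifting) rangeE someI_ex)
    then have "a \<in> P (Suc i)" using P by blast
    then have "C j a = c a" if "Suc i \<le> j" for j
      unfolding c_def i_def[symmetric] using that by (intro Cfrozen)
    then show ?thesis by blast
  qed
  have cN: "c a \<subseteq> N a \<and> card (c a) = 2" if "a \<in> A" for a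
    unfolding c_def using C[of "Suc (SOME i. ea i = a)"] that unfolding almost_factor_def by blast
  moreover have "card (holders c b) = 2" if ne: "holders c b \<noteq> {}" for b
  proof -
    have "b \<in> (\<Union>a\<in>A. N a)" using ne cN by (auto simp: holders_def)
    then obtain k where k: "b = eb k" using NB by blast
    have "a \<in> holders c b \<longleftrightarrow> a \<in> holders (C (Suc k)) b" for a
    proof (cases "a \<in> A")
      case True
      then obtain i where "\<forall>j\<ge>i. C j a = c a" using c by blast
      then have "C (max i (Suc k)) a = c a" by simp
      then have "a \<in> holders c b \<longleftrightarrow> a \<in> holders (C (max i (Suc k))) b" by (simp add: holders_def)
      then show ?thesis using Hfinal[of k "max i (Suc k)"] k by simp
    qed (simp add: holders_def)
    then have "holders c b = holders (C (Suc k)) b" by blast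
    moreover have "finite (holders (C (Suc k)) b)" using C by (simp add: almost_factor_def)
    ultimately show ?thesis using even[of k] k ne by auto
  qed
  ultimately show ?thesis by blast
qed

end

text \<open>A 2-regular subgraph need not be connected, so the whole factor is a single member
  \<open>H\<close> of the collection and disjointness is trivial.\<close>

theorem theorem2p12:
  fixes G :: "'a ugraph" and A B :: "'a set"
  assumes "bipartite_graph G A B"
    and "infinite A" and "infinite B"
    and "dHp_graph G A B"
    and "\<forall>a\<in>A. finite_degree G a"
    and "finite {b \<in> B. finite_degree G b}"
  shows "\<exists>\<C> :: 'a ugraph set.
           (\<forall>H\<in>\<C>. subgraph H G \<and> two_regular H) \<and>
           pairwise (\<lambda>H K. disjnt (verts H) (verts K)) \<C> \<and>
           A \<subseteq> (\<Union>H\<in>\<C>. verts H)"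
proof -
  let ?N = "neighbours G"
  have AB: "A \<inter> B = {}" "verts G = A \<union> B" using assms(1) by (auto simp: bipartite_graph_def)
  have edge: "a \<in> A \<longleftrightarrow> b \<in> B" if "b \<in> ?N a" for a b
  proof -
    have "\<exists>x\<in>A. \<exists>y\<in>B. {a, b} = {x, y}"
      using that assms(1) by (auto simp: neighbours_def bipartite_graph_def)
    then show ?thesis using AB by (auto simp: doubleton_eq_iff)
  qed
  have sym: "b \<in> ?N a \<longleftrightarrow> a \<in> ?N b" for a b by (simp add: neighbours_def insert_commute)
  interpret infinite_double_hall A ?N
  proof
    show "infinite A" by fact
    show "finite (?N a)" if "a \<in> A" for a using assms(5) that by (simp add: finite_degree_def)
    fix T assume T: "T \<subseteq> A" "finite T" "2 \<le> card T"
    have sub: "N2 G T \<subseteq> linked ?N T"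
    proof
      fix b assume "b \<in> N2 G T"
      then have "2 \<le> card (?N b \<inter> T)" using T(2) by (auto simp: N2_def at_least_two_def)
      then obtain D where D: "D \<subseteq> ?N b \<inter> T" "card D = 2" by (rule obtain_subset_with_card_n)
      then obtain a a' where "D = {a, a'}" "a \<noteq> a'" by (auto simp: card_2_iff)
      then show "b \<in> linked ?N T" unfolding linked_def using D(1) sym by blast
    qed
    have "linked ?N T \<subseteq> (\<Union>a\<in>T. ?N a)" by (auto simp: linked_def)
    then have fl: "finite (linked ?N T)"
      using T assms(5) by (elim finite_subset) (auto simp: finite_degree_def)
    have "T \<lesssim> N2 G T" using assms(4) T by (auto simp: dHp_graph_def at_least_two_def)
    then have "T \<lesssim> linked ?N T" using sub lepoll_trans subset_imp_lepoll by blast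
    then show "card T \<le> card (linked ?N T)" using fl by (simp add: lepoll_iff_card_le T(2))
  qed
  have hN: "holders ?N b = ?N b" if "b \<in> B" for b
    unfolding holders_def using that sym edge by blast
  \<comment> \<open>Elements of the type outside \<open>B\<close> have no holders; the nonemptiness
    condition keeps them out of the set required to be finite.\<close>
  have "{b. holders ?N b \<noteq> {} \<and> finite (holders ?N b)} \<subseteq> {b \<in> B. finite_degree G b}"
  proof
    fix b assume b: "b \<in> {b. holders ?N b \<noteq> {} \<and> finite (holders ?N b)}"
    then have "b \<in> B" using edge by (auto simp: holders_def)
    then show "b \<in> {b \<in> B. finite_degree G b}" using b hN by (simp add: finite_degree_def)
  qed
  then have "finite {b. holders ?N b \<noteq> {} \<and> finite (holders ?N b)}"
    using assms(6) finite_subset by blast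
  then obtain c where c: "\<And>a. a \<in> A \<Longrightarrow> c a \<subseteq> ?N a \<and> card (c a) = 2"
    and hc: "\<And>b. holders c b \<noteq> {} \<Longrightarrow> card (holders c b) = 2"
    using two_factor_exists by blast
  have cB: "c a \<subseteq> B" if "a \<in> A" for a using c[OF that] edge that by blast
  define H :: "'a ugraph" where
    "H = \<lparr>verts = A \<union> (\<Union>a\<in>A. c a), edges = {{a, b} | a b. a \<in> A \<and> b \<in> c a}\<rparr>"
  have NA: "neighbours H a = c a" if "a \<in> A" for a
    using that AB cB by (fastforce simp: neighbours_def H_def doubleton_eq_iff)
  have NB: "neighbours H b = holders c b" if "b \<in> B" for b
    using that AB cB by (fastforce simp: neighbours_def H_def doubleton_eq_iff holders_def)
  have "simple_graph H"
    unfolding simple_graph_def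
  proof
    fix e assume "e \<in> edges H"
    then obtain a b where ab: "e = {a, b}" "a \<in> A" "b \<in> c a" by (auto simp: H_def)
    then have "a \<noteq> b" using cB AB by blast
    then show "\<exists>u v. e = {u, v} \<and> u \<noteq> v \<and> u \<in> verts H \<and> v \<in> verts H"
      using ab by (intro exI[of _ a] exI[of _ b]) (auto simp: H_def)
  qed
  moreover have "verts H \<subseteq> verts G" using cB AB by (auto simp: H_def)
  moreover have "edges H \<subseteq> edges G" using c by (auto simp: H_def neighbours_def)
  ultimately have "subgraph H G" by (simp add: subgraph_def)
  moreover have "two_regular H"
    unfolding two_regular_def
  proof
    fix v assume "v \<in> verts H"
    then consider "v \<in> A" | a where "a \<in> A" "v \<in> c a" by (auto simp: H_def)
    then show "card (neighbours H v) = 2"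
    proof cases
      case 1 then show ?thesis using NA c by simp
    next
      case 2
      then have "v \<in> B" "holders c v \<noteq> {}" using cB by (auto simp: holders_def)
      then show ?thesis using NB hc by simp
    qed
  qed
  moreover have "A \<subseteq> verts H" by (auto simp: H_def)
  ultimately show ?thesis by (intro exI[of _ "{H}"]) (simp add: pairwise_def)
qed

end
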